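(* For every graph sequent $H\to A$ of $\mathrm{HL}$: if $\mathrm{HL}\vdash H\to A$, then the (universal closure of the) first-order formula $v(H\to A)$ is derivable in first-order intuitionistic logic.
   Context: Hypergraphs: given labels $C$ with $type:C\to\mathbb{N}$, a graph is $G=\langle V,E,att,lab,ext\rangle$ with finite $V,E$, $att:E\to V^\circledast$ (strings of distinct nodes), $lab:E\to C$ with $type(lab(e))=|att(e)|$, $ext\in V^\circledast$; $type(G)=|ext|$; isomorphic graphs identified. Handle $a^\bullet$: one edge labeled $a$ attached to $v_1\dots v_n$, all external in that order. Replacement $G[e/H]$: remove $e$, insert a disjoint copy of $H$, fuse $i$-th external node of $H$ with $i$-th attachment node of $e$; simultaneous replacement; relabeling $G[e:=a]$. $\mathrm{HL}$: primitive types $Pr$ with $type:Pr\to\mathbb{N}$ (infinitely many of each arity); symbol $\$$ of any arity. Types: primitives; $N\div D$ where $D$ has exactly one edge $d_0$ labeled $\$$, others labeled by types, $type(N)=type(D)$, $type(N\div D)=type_D(d_0)$; $\times(M)$ for a type-labeled graph $M$, $type(\times(M))=type(M)$. Graph sequent $H\to A$ with $type(H)=type(A)$. Axioms $p^\bullet\to p$. Rules: $(\div\to)$: for $N\div D$ with $E_D=\{d_0,\dots,d_k\}$, $e\in E_H$ labeled $N$: from $H\to A$, $H_i\to lab(d_i)$ infer $H[e/D][d_0:=N\div D][d_1/H_1,\dots,d_k/H_k]\to A$; $(\to\div)$: from $D[d_0/F]\to N$ infer $F\to N\div D$; $(\times\to)$: if $e\in E_G$ is labeled $\times(F)$, from $G[e/F]\to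 A$ infer $G\to A$; $(\to\times)$: with $E_M=\{m_1,\dots,m_l\}$, from $H_i\to lab(m_i)$ infer $M[m_1/H_1,\dots,m_l/H_l]\to\times(M)$. Translation $v$ (each type $T$ with $type(T)=k$ gives a formula $v(T)[x_1,\dots,x_k]$ with free variables among $x_1,\dots,x_k$): (i) a primitive type $p$ with $type(p)=k$ is a $k$-ary predicate symbol and $v(p)[x_1,\dots,x_k]=p(x_1,\dots,x_k)$. (ii) For $N\div D$ with $E_D=\{d_0,\dots,d_l\}$, $lab(d_0)=\$$, $att_D(d_0)=u_1\dots u_k$, $lab_D(d_i)=T_i$: let $f$ assign the variable $x_i$ to $u_i$ and distinct fresh variables $y_1,\dots,y_m$ to the remaining $m=|V_D|-k$ nodes; then $v(N\div D)[x_1,\dots,x_k]=\forall y_1\dots\forall y_m\big(v(T_1)[f(att_D(d_1))]\wedge\dots\wedge v(T_l)[f(att_D(d_l))]\to v(N)[f(ext_D)]\big)$. (iii) For $\times(M)$ with $E_M=\{m_1,\dots,m_l\}$, $lab_M(m_i)=T_i$, $ext_M=w_1\dots w_k$: let $g$ assign $x_i$ to $w_i$ and fresh $y_1,\dots,y_m$ to the other $m=|V_M|-k$ nodes; then $v(\times(M))[x_1,\dots,x_k]=\exists y_1\dots\exists y_m\big(v(T_1)[g(att_M(m_1))]\wedge\dots\wedge v(T_l)[g(att_M(m_l))]\big)$. An empty conjunction is $\top$; $f,g$ are applied letterwise to strings of nodes. (iv) For a sequent with $type(H)=k$: $v(H\to A)[x_1,\dots,x_k]=v(\times(H))[x_1,\dots,x_k]\to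 v(A)[x_1,\dots,x_k]$; free variables are read as universally quantified. *)

theory Defs
  imports Main
begin

text \<open>A hypergraph with nodes 0..<nverts; edges are a list of (label, attachment string);
  edge identities are list positions. Isomorphism is handled explicitly by giso.\<close>

datatype 'l hgraph = HGraph (nverts: nat) (edges: "('l \<times> nat list) list") (ext: "nat list")

text \<open>HL types; the label None plays the role of the symbol \$.\<close>
datatype tp = Prim nat nat | Div tp "tp option hgraph" | Times "tp hgraph"

definition wf_graph :: "'l hgraph \<Rightarrow> bool" where
  "wf_graph G \<longleftrightarrow> distinct (ext G) \<and> set (ext G) \<subseteq> {..<nverts G} \<and>
     (\<forall>(l,a)\<in>set (edges G). distinct a \<and> set a \<subseteq> {..<nverts G})"

definition dollar_att :: "tp option hgraph \<Rightarrow> nat list" where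
  "dollar_att D = (case find (\<lambda>(l,a). l = None) (edges D) of Some (_,a) \<Rightarrow> a | None \<Rightarrow> [])"

fun arity :: "tp \<Rightarrow> nat" where
  "arity (Prim p k) = k"
| "arity (Div N D) = length (dollar_att D)"
| "arity (Times M) = length (ext M)"

inductive wf_tp :: "tp \<Rightarrow> bool" where
  "wf_tp (Prim p k)"
| "wf_tp N \<Longrightarrow> wf_graph D \<Longrightarrow> length (filter (\<lambda>(l,a). l = None) (edges D)) = 1 \<Longrightarrow>
   (\<forall>T a. (Some T, a) \<in> set (edges D) \<longrightarrow> wf_tp T \<and> arity T = length a) \<Longrightarrow>
   arity N = length (ext D) \<Longrightarrow> wf_tp (Div N D)"
| "wf_graph M \<Longrightarrow> (\<forall>T a. (T, a) \<in> set (edges M) \<longrightarrow> wf_tp T \<and> arity T = length a) \<Longrightarrow>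
   wf_tp (Times M)"

definition wf_lgraph :: "tp hgraph \<Rightarrow> bool" where
  "wf_lgraph G \<longleftrightarrow> wf_graph G \<and> (\<forall>T a. (T, a) \<in> set (edges G) \<longrightarrow> wf_tp T \<and> arity T = length a)"

definition seq_ok :: "tp hgraph \<Rightarrow> tp \<Rightarrow> bool" where
  "seq_ok H A \<longleftrightarrow> wf_lgraph H \<and> wf_tp A \<and> length (ext H) = arity A"

definition handle :: "tp \<Rightarrow> tp hgraph" where
  "handle T = HGraph (arity T) [(T, [0..<arity T])] [0..<arity T]"

definition pos :: "nat list \<Rightarrow> nat \<Rightarrow> nat" where
  "pos xs v = length (takeWhile (\<lambda>w. w \<noteq> v) xs)"

definition irank :: "'l hgraph \<Rightarrow> nat \<Rightarrow> nat" where
  "irank H v = length (filter (\<lambda>w. w \<notin> set (ext H)) [0..<v])"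

definition embed :: "'l hgraph \<Rightarrow> nat list \<Rightarrow> nat \<Rightarrow> nat \<Rightarrow> nat" where
  "embed H a c v = (if v \<in> set (ext H) then a ! pos (ext H) v else c + irank H v)"

fun repl_aux :: "(nat \<Rightarrow> 'l hgraph option) \<Rightarrow> nat \<Rightarrow> nat \<Rightarrow> ('l \<times> nat list) list
    \<Rightarrow> nat \<times> ('l \<times> nat list) list" where
  "repl_aux \<sigma> i c [] = (c, [])"
| "repl_aux \<sigma> i c ((l,a) # es) = (case \<sigma> i of
      None \<Rightarrow> (let (c', es') = repl_aux \<sigma> (Suc i) c es in (c', (l,a) # es'))
    | Some H \<Rightarrow> (let (c', es') = repl_aux \<sigma> (Suc i) (c + irank H (nverts H)) es in
         (c', map (\<lambda>(l',a'). (l', map (embed H a c) a')) (edges H) @ es')))"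

definition repl :: "'l hgraph \<Rightarrow> (nat \<Rightarrow> 'l hgraph option) \<Rightarrow> 'l hgraph" where
  "repl G \<sigma> = (let (c, es) = repl_aux \<sigma> 0 (nverts G) (edges G) in HGraph c es (ext G))"

definition sing :: "nat \<Rightarrow> 'l hgraph \<Rightarrow> nat \<Rightarrow> 'l hgraph option" where
  "sing e H = (\<lambda>i. if i = e then Some H else None)"

definition relab :: "'l hgraph \<Rightarrow> nat \<Rightarrow> 'l \<Rightarrow> 'l hgraph" where
  "relab G e a = HGraph (nverts G) ((edges G)[e := (a, snd (edges G ! e))]) (ext G)"

definition giso :: "('a \<Rightarrow> 'b \<Rightarrow> bool) \<Rightarrow> 'a hgraph \<Rightarrow> 'b hgraph \<Rightarrow> bool" where
  "giso R G G' \<longleftrightarrow> nverts G = nverts G' \<and> length (edges G) = length (edges G') \<and>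
     (\<exists>\<pi> \<sigma>. bij_betw \<pi> {..<nverts G} {..<nverts G'} \<and>
        bij_betw \<sigma> {..<length (edges G)} {..<length (edges G')} \<and>
        ext G' = map \<pi> (ext G) \<and>
        (\<forall>i<length (edges G). R (fst (edges G ! i)) (fst (edges G' ! \<sigma> i)) \<and>
            snd (edges G' ! \<sigma> i) = map \<pi> (snd (edges G ! i))))"

lemma giso_mono[mono]: "R \<le> S \<Longrightarrow> giso R \<le> giso S"
  unfolding giso_def le_fun_def le_bool_def by blast

inductive teq :: "tp \<Rightarrow> tp \<Rightarrow> bool" where
  "teq (Prim p k) (Prim p k)"
| "teq N N' \<Longrightarrow> giso (rel_option teq) D D' \<Longrightarrow> teq (Div N D) (Div N' D')"
| "giso teq M M' \<Longrightarrow> teq (Times M) (Times M')"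

text \<open>H[e/D][d0 := N / D][d_1/H_1,...,d_k/H_k]; Hs is indexed by the edges of D (entry d0 unused)\<close>
definition divL_graph :: "tp hgraph \<Rightarrow> nat \<Rightarrow> tp \<Rightarrow> tp option hgraph \<Rightarrow> nat \<Rightarrow> tp hgraph list \<Rightarrow> tp hgraph" where
  "divL_graph H e N D d0 Hs =
    (let H1 = repl (map_hgraph Some H) (sing e D);
         H2 = relab H1 (e + d0) (Some (Div N D));
         H3 = repl H2 (\<lambda>j. if e \<le> j \<and> j < e + length (edges D) \<and> j \<noteq> e + d0
                             then Some (map_hgraph Some (Hs ! (j - e))) else None)
     in map_hgraph the H3)"

inductive hl :: "tp hgraph \<Rightarrow> tp \<Rightarrow> bool" where
  ax: "hl (handle (Prim p k)) (Prim p k)"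
| divL: "hl H A \<Longrightarrow> e < length (edges H) \<Longrightarrow> fst (edges H ! e) = N \<Longrightarrow> wf_tp (Div N D) \<Longrightarrow>
    d0 < length (edges D) \<Longrightarrow> fst (edges D ! d0) = None \<Longrightarrow> length Hs = length (edges D) \<Longrightarrow>
    (\<forall>j<length (edges D). j \<noteq> d0 \<longrightarrow> hl (Hs ! j) (the (fst (edges D ! j)))) \<Longrightarrow>
    hl (divL_graph H e N D d0 Hs) A"
| divR: "hl (map_hgraph the (repl D (sing d0 (map_hgraph Some F)))) N \<Longrightarrow> wf_tp (Div N D) \<Longrightarrow>
    d0 < length (edges D) \<Longrightarrow> fst (edges D ! d0) = None \<Longrightarrow> wf_lgraph F \<Longrightarrow>
    length (ext F) = arity (Div N D) \<Longrightarrow> hl F (Div N D)"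
| timesL: "hl (repl G (sing e F)) A \<Longrightarrow> e < length (edges G) \<Longrightarrow> fst (edges G ! e) = Times F \<Longrightarrow>
    wf_lgraph G \<Longrightarrow> hl G A"
| timesR: "wf_tp (Times M) \<Longrightarrow> length Hs = length (edges M) \<Longrightarrow>
    (\<forall>i<length (edges M). hl (Hs ! i) (fst (edges M ! i))) \<Longrightarrow>
    hl (repl M (\<lambda>i. if i < length (edges M) then Some (Hs ! i) else None)) (Times M)"
| iso: "hl H A \<Longrightarrow> giso teq H H' \<Longrightarrow> teq A A' \<Longrightarrow> hl H' A'"

text \<open>Predicate symbols are pairs (name, arity), one for each primitive type.\<close>
datatype fm = Atom "nat \<times> nat" "nat list" | Top | Bot | Conj fm fm | Disj fm fm | Imp fm fm
  | All nat fm | Ex nat fm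

fun fv :: "fm \<Rightarrow> nat set" where
  "fv (Atom p xs) = set xs"
| "fv Top = {}"
| "fv Bot = {}"
| "fv (Conj a b) = fv a \<union> fv b"
| "fv (Disj a b) = fv a \<union> fv b"
| "fv (Imp a b) = fv a \<union> fv b"
| "fv (All x a) = fv a - {x}"
| "fv (Ex x a) = fv a - {x}"

fun sub :: "nat \<Rightarrow> nat \<Rightarrow> fm \<Rightarrow> fm" where
  "sub x y (Atom p xs) = Atom p (map (\<lambda>z. if z = x then y else z) xs)"
| "sub x y Top = Top"
| "sub x y Bot = Bot"
| "sub x y (Conj a b) = Conj (sub x y a) (sub x y b)"
| "sub x y (Disj a b) = Disj (sub x y a) (sub x y b)"
| "sub x y (Imp a b) = Imp (sub x y a) (sub x y b)"
| "sub x y (All z a) = (if z = x then All z a else All z (sub x y a))"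
| "sub x y (Ex z a) = (if z = x then Ex z a else Ex z (sub x y a))"

fun freefor :: "nat \<Rightarrow> nat \<Rightarrow> fm \<Rightarrow> bool" where
  "freefor y x (Atom p xs) = True"
| "freefor y x Top = True"
| "freefor y x Bot = True"
| "freefor y x (Conj a b) = (freefor y x a \<and> freefor y x b)"
| "freefor y x (Disj a b) = (freefor y x a \<and> freefor y x b)"
| "freefor y x (Imp a b) = (freefor y x a \<and> freefor y x b)"
| "freefor y x (All z a) = (x \<notin> fv (All z a) \<or> (z \<noteq> y \<and> freefor y x a))"
| "freefor y x (Ex z a) = (x \<notin> fv (Ex z a) \<or> (z \<noteq> y \<and> freefor y x a))"

inductive nd :: "fm set \<Rightarrow> fm \<Rightarrow> bool" where
  Assm: "a \<in> \<Gamma> \<Longrightarrow> nd \<Gamma> a"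
| TopI: "nd \<Gamma> Top"
| BotE: "nd \<Gamma> Bot \<Longrightarrow> nd \<Gamma> a"
| ConjI: "nd \<Gamma> a \<Longrightarrow> nd \<Gamma> b \<Longrightarrow> nd \<Gamma> (Conj a b)"
| ConjE1: "nd \<Gamma> (Conj a b) \<Longrightarrow> nd \<Gamma> a"
| ConjE2: "nd \<Gamma> (Conj a b) \<Longrightarrow> nd \<Gamma> b"
| DisjI1: "nd \<Gamma> a \<Longrightarrow> nd \<Gamma> (Disj a b)"
| DisjI2: "nd \<Gamma> b \<Longrightarrow> nd \<Gamma> (Disj a b)"
| DisjE: "nd \<Gamma> (Disj a b) \<Longrightarrow> nd (insert a \<Gamma>) c \<Longrightarrow> nd (insert b \<Gamma>) c \<Longrightarrow> nd \<Gamma> c"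
| ImpI: "nd (insert a \<Gamma>) b \<Longrightarrow> nd \<Gamma> (Imp a b)"
| ImpE: "nd \<Gamma> (Imp a b) \<Longrightarrow> nd \<Gamma> a \<Longrightarrow> nd \<Gamma> b"
| AllI: "nd \<Gamma> a \<Longrightarrow> x \<notin> \<Union> (fv ` \<Gamma>) \<Longrightarrow> nd \<Gamma> (All x a)"
| AllE: "nd \<Gamma> (All x a) \<Longrightarrow> freefor y x a \<Longrightarrow> nd \<Gamma> (sub x y a)"
| ExI: "nd \<Gamma> (sub x y a) \<Longrightarrow> freefor y x a \<Longrightarrow> nd \<Gamma> (Ex x a)"
| ExE: "nd \<Gamma> (Ex x a) \<Longrightarrow> nd (insert a \<Gamma>) b \<Longrightarrow> x \<notin> fv b \<Longrightarrow> x \<notin> \<Union> (fv ` \<Gamma>) \<Longrightarrow> nd \<Gamma> b"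

definition univ_close :: "fm \<Rightarrow> fm" where
  "univ_close a = foldr All (sorted_list_of_set (fv a)) a"

fun conjs :: "fm list \<Rightarrow> fm" where
  "conjs [] = Top"
| "conjs [a] = a"
| "conjs (a # as) = Conj a (conjs as)"

text \<open>Assignment of variables to the nodes of a graph: the nodes in u get xs (in order),
  the remaining nodes get distinct fresh variables (larger than all of xs).\<close>
definition vassign :: "nat list \<Rightarrow> nat list \<Rightarrow> nat \<Rightarrow> nat" where
  "vassign u xs v = (if v \<in> set u then xs ! pos u v
     else Suc (Max (insert 0 (set xs))) + length (filter (\<lambda>w. w \<notin> set u) [0..<v]))"

definition fresh_nodes :: "nat list \<Rightarrow> nat \<Rightarrow> nat list" where
  "fresh_nodes u n = filter (\<lambda>w. w \<notin> set u) [0..<n]"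

lemma size_hgraph_edge: "(l, a) \<in> set (edges G) \<Longrightarrow> f l \<le> size_hgraph f G"
proof (cases G)
  case (HGraph n es x)
  assume "(l, a) \<in> set (edges G)"
  then have "size_prod f (\<lambda>_. 0) (l, a) \<le> size_list (size_prod f (\<lambda>_. 0)) es"
    using HGraph by (auto intro: size_list_estimation')
  then show ?thesis using HGraph by simp
qed

function tr :: "tp \<Rightarrow> nat list \<Rightarrow> fm" where
  "tr (Prim p k) xs = Atom (p, k) xs"
| "tr (Div N D) xs =
    foldr All (map (vassign (dollar_att D) xs) (fresh_nodes (dollar_att D) (nverts D)))
      (Imp (conjs (concat (map (\<lambda>(l,a). case l of None \<Rightarrow> []
                               | Some T \<Rightarrow> [tr T (map (vassign (dollar_att D) xs) a)]) (edges D))))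
           (tr N (map (vassign (dollar_att D) xs) (ext D))))"
| "tr (Times M) xs =
    foldr Ex (map (vassign (ext M) xs) (fresh_nodes (ext M) (nverts M)))
      (conjs (map (\<lambda>(T,a). tr T (map (vassign (ext M) xs) a)) (edges M)))"
  by pat_completeness auto
termination
  apply (relation "measure (\<lambda>(T,xs). size T)")
  apply auto
   apply (drule size_hgraph_edge[where f = "size_option size"]; simp)
  apply (drule size_hgraph_edge[where f = size]; simp)
  done

text \<open>v(H \<rightarrow> A)[x_1..x_k] with x_i = i-1\<close>
definition vseq :: "tp hgraph \<Rightarrow> tp \<Rightarrow> fm" where
  "vseq H A = Imp (tr (Times H) [0..<length (ext H)]) (tr A [0..<length (ext H)])"

end

theory Submission
  imports Defs
begin

text \<open>Derivability coincides with forcing in a model whose elements are the variables and whose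
  worlds are formulas ordered by entailment. Forcing \<open>v(N \<div> D)\<close> or \<open>v(\<times>(M))\<close> then amounts to a
  quantification over all assignments of variables to the nodes of \<open>D\<close> or \<open>M\<close>, independent of the
  bound variables chosen by the translation. By induction on derivations of \<open>H \<rightarrow> A\<close>,
  every assignment \<open>g\<close> of variables to the nodes of \<open>H\<close> under which a formula entails the
  translations of all edges of \<open>H\<close> makes it entail \<open>v(A)[g(ext H)]\<close>: an assignment on the result of
  a replacement restricts to the parts, and compatible assignments on the parts can be glued.\<close>

subsection \<open>Entailment between formulas\<close>

text \<open>The obstacle is that \<open>tr\<close> chooses its bound variables from its arguments:
  they lie above the maximum of \<open>xs\<close>. Renaming the free variables of
  \<open>tr T xs\<close> therefore gives \<open>tr T (map f xs)\<close> only up to the names of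
  bound variables, and a direct substitution into the nested formulas that arise from replacement
  would have to settle capture at every step. Variables suffice as individuals of the model because
  the language has no function symbols and a variable that is fresh for the current world acts as a
  generic element. Assignments are not restricted to injective ones: a quantifier may be
  instantiated with a variable already in use, so distinct nodes may denote the same
  variable.\<close>

text \<open>The calculus \<^const>\<open>nd\<close> does not admit weakening: an eigenvariable must avoid the whole
  context, so \<open>P x, \<forall>y. Q y\<close> does not derive \<open>\<forall>x. Q x\<close>. Entailment between single formulas, read
  as derivability of the implication from no assumptions, is well behaved.\<close>

definition ent :: "fm \<Rightarrow> fm \<Rightarrow> bool" (infix "\<turnstile>" 50) where
  "\<gamma> \<turnstile> a \<longleftrightarrow> nd {} (Imp \<gamma> a)"

lemma nd_mp2: "nd {} (Imp p (Imp q r)) \<Longrightarrow> nd {} p \<Longrightarrow> nd {} q \<Longrightarrow> nd {} r"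
  using ImpE by blast

text \<open>Without weakening, a closed derivation of \<open>b\<close> is brought under
  \<open>\<gamma>\<close> by a cut against the theorem \<open>Imp b (Imp \<gamma> b)\<close>.
  Together with \<open>nd_S\<close> this gives Hilbert-style reasoning under one assumption.\<close>

lemma nd_K: "nd {} b \<Longrightarrow> \<gamma> \<turnstile> b"
  unfolding ent_def by (rule ImpE[of _ b], intro ImpI, rule Assm, auto)

lemma nd_S: "\<gamma> \<turnstile> Imp a b \<Longrightarrow> \<gamma> \<turnstile> a \<Longrightarrow> \<gamma> \<turnstile> b"
  unfolding ent_def
proof (rule nd_mp2)
  let ?\<Delta> = "{\<gamma>, Imp \<gamma> a, Imp \<gamma> (Imp a b)}"
  have "nd ?\<Delta> (Imp a b)" "nd ?\<Delta> a" by (rule ImpE[of _ \<gamma>]; rule Assm; simp)+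
  then have "nd ?\<Delta> b" by (rule ImpE)
  then show "nd {} (Imp (Imp \<gamma> (Imp a b)) (Imp (Imp \<gamma> a) (Imp \<gamma> b)))" by (intro ImpI)
qed

lemma ent_refl [simp, intro]: "a \<turnstile> a"
  unfolding ent_def by (auto intro: ImpI Assm)

lemma ent_MP: "a \<turnstile> b \<Longrightarrow> \<gamma> \<turnstile> a \<Longrightarrow> \<gamma> \<turnstile> b"
  using nd_K nd_S ent_def by metis

lemma ent_trans [trans]: "\<gamma> \<turnstile> a \<Longrightarrow> a \<turnstile> b \<Longrightarrow> \<gamma> \<turnstile> b"
  by (rule ent_MP)

lemma ent_Top [simp]: "\<gamma> \<turnstile> Top"
  by (simp add: nd_K TopI)

lemma Conj_ent1: "Conj a b \<turnstile> a" and Conj_ent2: "Conj a b \<turnstile> b"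
  unfolding ent_def by (auto intro!: ImpI intro: ConjE1[of _ a b] ConjE2[of _ a b] Assm)

lemma ent_Conj: "\<gamma> \<turnstile> Conj a b \<longleftrightarrow> \<gamma> \<turnstile> a \<and> \<gamma> \<turnstile> b"
proof
  have "nd {} (Imp a (Imp b (Conj a b)))"
    by (intro ImpI ConjI; rule Assm; simp)
  then show "\<gamma> \<turnstile> a \<and> \<gamma> \<turnstile> b \<Longrightarrow> \<gamma> \<turnstile> Conj a b"
    using nd_K nd_S by blast
qed (blast intro: ent_trans Conj_ent1 Conj_ent2)

lemma Conj_ent_mono: "a \<turnstile> a' \<Longrightarrow> b \<turnstile> b' \<Longrightarrow> Conj a b \<turnstile> Conj a' b'"
  by (meson Conj_ent1 Conj_ent2 ent_Conj ent_trans)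

lemma ent_Imp: "\<gamma> \<turnstile> Imp a b \<longleftrightarrow> Conj \<gamma> a \<turnstile> b"
proof
  show "\<gamma> \<turnstile> Imp a b \<Longrightarrow> Conj \<gamma> a \<turnstile> b"
    using Conj_ent1 Conj_ent2 ent_trans nd_S by blast
  have "nd {Imp (Conj \<gamma> a) b, \<gamma>, a} b"
    by (rule ImpE[of _ "Conj \<gamma> a"]) (auto intro: ConjI Assm)
  then have "nd {} (Imp (Imp (Conj \<gamma> a) b) (Imp \<gamma> (Imp a b)))"
    by (auto intro!: ImpI simp: insert_commute)
  then show "Conj \<gamma> a \<turnstile> b \<Longrightarrow> \<gamma> \<turnstile> Imp a b"
    unfolding ent_def using ImpE by blast
qed

lemma Imp_ent_mono: "a' \<turnstile> a \<Longrightarrow> b \<turnstile> b' \<Longrightarrow> Imp a b \<turnstile> Imp a' b'"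
  by (meson Conj_ent1 Conj_ent2 ent_Imp ent_trans nd_S)

lemma ent_DisjI1: "\<gamma> \<turnstile> a \<Longrightarrow> \<gamma> \<turnstile> Disj a b" and ent_DisjI2: "\<gamma> \<turnstile> b \<Longrightarrow> \<gamma> \<turnstile> Disj a b"
proof -
  have "a \<turnstile> Disj a b" "b \<turnstile> Disj a b"
    unfolding ent_def by (auto intro!: ImpI intro: DisjI1 DisjI2 Assm)
  then show "\<gamma> \<turnstile> a \<Longrightarrow> \<gamma> \<turnstile> Disj a b" "\<gamma> \<turnstile> b \<Longrightarrow> \<gamma> \<turnstile> Disj a b"
    by (blast intro: ent_trans)+
qed

lemma Disj_ent: "a \<turnstile> c \<Longrightarrow> b \<turnstile> c \<Longrightarrow> Disj a b \<turnstile> c"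
proof -
  have "nd {Disj a b, Imp b c, Imp a c} c"
    by (rule DisjE[of _ a b]) (auto intro: Assm ImpE[of _ a] ImpE[of _ b])
  then have "nd {} (Imp (Imp a c) (Imp (Imp b c) (Imp (Disj a b) c)))"
    by (auto intro!: ImpI)
  then show "a \<turnstile> c \<Longrightarrow> b \<turnstile> c \<Longrightarrow> Disj a b \<turnstile> c"
    unfolding ent_def by (rule nd_mp2)
qed

lemma Disj_ent_mono: "a \<turnstile> a' \<Longrightarrow> b \<turnstile> b' \<Longrightarrow> Disj a b \<turnstile> Disj a' b'"
  by (simp add: Disj_ent ent_DisjI1 ent_DisjI2)

section \<open>Quantifier rules for entailment\<close>

lemma sub_self [simp]: "sub x x a = a"
  by (induction a) (auto simp: map_idI)

lemma freefor_self [simp]: "freefor x x a"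
  by (induction a) auto

lemma AllE_self: "nd \<Gamma> (All x a) \<Longrightarrow> nd \<Gamma> a"
  using AllE[of \<Gamma> x a x] by simp

text \<open>Generalization is applied to \<open>Imp \<gamma> a\<close> in the empty context, where
  every variable is admissible. A closed theorem then moves the quantifier inward; its assumptions
  \<open>\<gamma>\<close> and \<open>All x (Imp \<gamma> a)\<close> do not contain \<open>x\<close>
  free.\<close>

lemma ent_AllI: "\<gamma> \<turnstile> a \<Longrightarrow> x \<notin> fv \<gamma> \<Longrightarrow> \<gamma> \<turnstile> All x a"
proof -
  assume "\<gamma> \<turnstile> a" and x: "x \<notin> fv \<gamma>"
  then have "nd {} (All x (Imp \<gamma> a))"
    unfolding ent_def by (auto intro: AllI)
  moreover have "nd {\<gamma>, All x (Imp \<gamma> a)} (Imp \<gamma> a)"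
    by (rule AllE_self[of _ x], rule Assm, simp)
  then have "nd {\<gamma>, All x (Imp \<gamma> a)} a"
    by (rule ImpE) (simp add: Assm)
  then have "nd {\<gamma>, All x (Imp \<gamma> a)} (All x a)"
    using x by (auto intro: AllI)
  then have "nd {} (Imp (All x (Imp \<gamma> a)) (Imp \<gamma> (All x a)))"
    by (intro ImpI)
  ultimately show ?thesis
    unfolding ent_def using ImpE by metis
qed

lemma All_ent: "freefor y x a \<Longrightarrow> All x a \<turnstile> sub x y a"
  unfolding ent_def by (auto intro!: ImpI AllE intro: Assm)

lemma ent_Ex: "freefor y x a \<Longrightarrow> sub x y a \<turnstile> Ex x a"
  unfolding ent_def by (rule ImpI, rule ExI[of _ x y a]) (auto intro: Assm)

lemma Ex_ent: "a \<turnstile> c \<Longrightarrow> x \<notin> fv c \<Longrightarrow> Ex x a \<turnstile> c"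
proof -
  assume "a \<turnstile> c" and x: "x \<notin> fv c"
  then have "nd {} (All x (Imp a c))"
    unfolding ent_def by (auto intro: AllI)
  moreover have "nd {a, Ex x a, All x (Imp a c)} (Imp a c)"
    by (rule AllE_self[of _ x], rule Assm, simp)
  then have "nd {a, Ex x a, All x (Imp a c)} c"
    by (rule ImpE) (simp add: Assm)
  then have "nd {Ex x a, All x (Imp a c)} c"
    using x by - (rule ExE[OF Assm, of x a]; simp)
  then have "nd {} (Imp (All x (Imp a c)) (Imp (Ex x a) c))"
    by (intro ImpI)
  ultimately show ?thesis
    unfolding ent_def using ImpE by metis
qed

subsection \<open>Capture-avoiding renaming\<close>

text \<open>\<open>inst f a c\<close>: the formula \<open>c\<close> arises from \<open>a\<close> by the simultaneous capture-avoiding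
  renaming \<open>f\<close>, with an arbitrary choice of bound variables.\<close>

fun inst :: "(nat \<Rightarrow> nat) \<Rightarrow> fm \<Rightarrow> fm \<Rightarrow> bool" where
  "inst f (Atom p xs) c \<longleftrightarrow> c = Atom p (map f xs)"
| "inst f Top c \<longleftrightarrow> c = Top"
| "inst f Bot c \<longleftrightarrow> c = Bot"
| "inst f (Conj a b) c \<longleftrightarrow> (\<exists>a' b'. c = Conj a' b' \<and> inst f a a' \<and> inst f b b')"
| "inst f (Disj a b) c \<longleftrightarrow> (\<exists>a' b'. c = Disj a' b' \<and> inst f a a' \<and> inst f b b')"
| "inst f (Imp a b) c \<longleftrightarrow> (\<exists>a' b'. c = Imp a' b' \<and> inst f a a' \<and> inst f b b')"
| "inst f (All x a) c \<longleftrightarrow>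
    (\<exists>z b. c = All z b \<and> z \<notin> f ` (fv a - {x}) \<and> inst (f(x := z)) a b)"
| "inst f (Ex x a) c \<longleftrightarrow>
    (\<exists>z b. c = Ex z b \<and> z \<notin> f ` (fv a - {x}) \<and> inst (f(x := z)) a b)"

fun bv :: "fm \<Rightarrow> nat set" where
  "bv (Atom p xs) = {}"
| "bv Top = {}"
| "bv Bot = {}"
| "bv (Conj a b) = bv a \<union> bv b"
| "bv (Disj a b) = bv a \<union> bv b"
| "bv (Imp a b) = bv a \<union> bv b"
| "bv (All x a) = insert x (bv a)"
| "bv (Ex x a) = insert x (bv a)"

lemma finite_fv [simp]: "finite (fv a)"
  by (induction a) auto

lemma freefor_bv: "y \<notin> bv a \<Longrightarrow> freefor y x a"
  by (induction a) auto

lemma inst_cong: "(\<And>v. v \<in> fv a \<Longrightarrow> f v = g v) \<Longrightarrow> inst f a c \<longleftrightarrow> inst g a c"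
proof (induction a arbitrary: f g c)
  case (All x a)
  have "inst (f(x := z)) a b = inst (g(x := z)) a b" for z b
    using All.prems by (intro All.IH) auto
  moreover have "f ` (fv a - {x}) = g ` (fv a - {x})"
    using All.prems by (intro image_cong) auto
  ultimately show ?case by simp
next
  case (Ex x a)
  have "inst (f(x := z)) a b = inst (g(x := z)) a b" for z b
    using Ex.prems by (intro Ex.IH) auto
  moreover have "f ` (fv a - {x}) = g ` (fv a - {x})"
    using Ex.prems by (intro image_cong) auto
  ultimately show ?case by simp
next
  case (Conj a1 a2)
  have "inst f a1 = inst g a1" "inst f a2 = inst g a2"
    by (intro ext Conj.IH; simp add: Conj.prems)+
  then show ?case by simp
next
  case (Disj a1 a2)
  have "inst f a1 = inst g a1" "inst f a2 = inst g a2"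
    by (intro ext Disj.IH; simp add: Disj.prems)+
  then show ?case by simp
next
  case (Imp a1 a2)
  have "inst f a1 = inst g a1" "inst f a2 = inst g a2"
    by (intro ext Imp.IH; simp add: Imp.prems)+
  then show ?case by simp
qed auto

lemma inst_id: "inst id a a"
  by (induction a) (auto simp: fun_upd_idem)

lemma inst_fv: "inst f a c \<Longrightarrow> fv c = f ` fv a"
  by (induction a arbitrary: f c) (fastforce simp: image_Un)+

text \<open>Source of all freshness below. A binder is sent to some \<open>z\<close> outside
  \<open>X\<close> and outside the values of \<open>f\<close> on the free variables of the body, so
  nothing is captured; \<open>f\<close> stays arbitrary because each binder updates it.\<close>

lemma inst_avoiding:
  assumes "finite X"
  obtains c where "inst f a c" "bv c \<inter> X = {}"
proof -
  have "\<exists>c. inst f a c \<and> bv c \<inter> X = {}"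
  proof (induction a arbitrary: f)
    case (All x a)
    have "finite (X \<union> f ` fv a)" using assms by simp
    then obtain z where "z \<notin> X \<union> f ` fv a" using ex_new_if_finite infinite_UNIV_nat by blast
    moreover obtain b where "inst (f(x := z)) a b" "bv b \<inter> X = {}" using All by blast
    ultimately show ?case by (intro exI[of _ "All z b"]) auto
  next
    case (Ex x a)
    have "finite (X \<union> f ` fv a)" using assms by simp
    then obtain z where "z \<notin> X \<union> f ` fv a" using ex_new_if_finite infinite_UNIV_nat by blast
    moreover obtain b where "inst (f(x := z)) a b" "bv b \<inter> X = {}" using Ex by blast
    ultimately show ?case by (intro exI[of _ "Ex z b"]) auto
  next
    case (Conj a b)
    then obtain a' b' where "inst f a a'" "bv a' \<inter> X = {}" "inst f b b'" "bv b' \<inter> X = {}" by meson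
    then show ?case by (intro exI[of _ "Conj a' b'"]) auto
  next
    case (Disj a b)
    then obtain a' b' where "inst f a a'" "bv a' \<inter> X = {}" "inst f b b'" "bv b' \<inter> X = {}" by meson
    then show ?case by (intro exI[of _ "Disj a' b'"]) auto
  next
    case (Imp a b)
    then obtain a' b' where "inst f a a'" "bv a' \<inter> X = {}" "inst f b b'" "bv b' \<inter> X = {}" by meson
    then show ?case by (intro exI[of _ "Imp a' b'"]) auto
  qed auto
  then show thesis using that by blast
qed

text \<open>The step shared by both quantifiers. If \<open>z = x\<close>, the substitution stops at
  the binder, and the capture condition says that no other free variable is sent to
  \<open>x\<close>. Otherwise it passes under the binder, and \<open>y \<noteq> z\<close> keeps the
  new name from being captured.\<close>

lemma inst_sub_binder:
  assumes IH: "\<And>f c. inst f a c \<Longrightarrow> y \<notin> bv c \<Longrightarrow>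
      inst (\<lambda>v. if f v = x then y else f v) a (sub x y c)"
    and b: "inst (f(w := z)) a b" "z \<notin> f ` (fv a - {w})" "y \<notin> bv b" "y \<noteq> z"
  shows "z \<notin> (\<lambda>v. if f v = x then y else f v) ` (fv a - {w}) \<and>
    inst ((\<lambda>v. if f v = x then y else f v)(w := z)) a (if z = x then b else sub x y b)"
proof (cases "z = x")
  case True
  then have "inst ((\<lambda>v. if f v = x then y else f v)(w := z)) a b = inst (f(w := z)) a b"
    using b by (intro inst_cong) auto
  then show ?thesis using b True by auto
next
  case False
  have "(\<lambda>v. if (f(w := z)) v = x then y else (f(w := z)) v)
      = (\<lambda>v. if f v = x then y else f v)(w := z)"
    using False by auto
  then show ?thesis using IH[OF b(1,3)] b False by auto
qed

lemma inst_sub: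
  "inst f a c \<Longrightarrow> y \<notin> bv c \<Longrightarrow> inst (\<lambda>v. if f v = x then y else f v) a (sub x y c)"
proof (induction a arbitrary: f c)
  case (All w a)
  then obtain z b where c: "c = All z b" "z \<notin> f ` (fv a - {w})" "inst (f(w := z)) a b" by auto
  show ?case using inst_sub_binder[OF All.IH c(3,2)] c(1) All.prems(2) by (cases "z = x") auto
next
  case (Ex w a)
  then obtain z b where c: "c = Ex z b" "z \<notin> f ` (fv a - {w})" "inst (f(w := z)) a b" by auto
  show ?case using inst_sub_binder[OF Ex.IH c(3,2)] c(1) Ex.prems(2) by (cases "z = x") auto
qed fastforce+

text \<open>Among the free variables of \<open>a\<close> only \<open>x\<close> is sent to
  \<open>z\<close>, so replacing \<open>z\<close> by \<open>y\<close> in the result redirects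
  \<open>x\<close> alone.\<close>

lemma inst_upd_sub:
  assumes "inst (f(x := z)) a b" "z \<notin> f ` (fv a - {x})" "y \<notin> bv b"
  shows "inst (f(x := y)) a (sub z y b)"
  using inst_sub[OF assms(1,3), of z] assms(2)
  by (subst inst_cong[of _ _ "\<lambda>v. if (f(x := z)) v = z then y else (f(x := z)) v"]) auto

text \<open>Two values of one renaming differ only in bound variables, so this is derivability of
  alpha-conversion. Keeping \<open>c\<close> and \<open>c'\<close> arbitrary lets the induction
  hypothesis be used in reverse on the left of \<open>Imp\<close>.\<close>

lemma inst_ent: "inst f a c \<Longrightarrow> inst f a c' \<Longrightarrow> c \<turnstile> c'"
proof (induction a arbitrary: f c c')
  case (All x a)
  obtain z b where c: "c = All z b" "z \<notin> f ` (fv a - {x})" "inst (f(x := z)) a b"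
    using All.prems by auto
  obtain z' b' where c': "c' = All z' b'" "z' \<notin> f ` (fv a - {x})" "inst (f(x := z')) a b'"
    using All.prems by auto
  \<comment> \<open>A variant of \<open>b\<close> without a binder named \<open>z'\<close>, so that
    instantiating \<open>z\<close> by \<open>z'\<close> in it is capture-free.\<close>
  obtain b'' where b'': "inst (f(x := z)) a b''" "bv b'' \<inter> {z'} = {}"
    using inst_avoiding by (metis finite.emptyI finite.insertI)
  have fvc: "fv c = f ` (fv a - {x})" using inst_fv[OF All.prems(1)] by simp
  have "c \<turnstile> b" using All_ent[of z z b] c by simp
  also have "b \<turnstile> b''" using All.IH c b'' by blast
  finally have "c \<turnstile> All z b''" using fvc c by (intro ent_AllI) auto
  also have "All z b'' \<turnstile> sub z z' b''" using b'' by (intro All_ent freefor_bv) auto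
  also have "sub z z' b'' \<turnstile> b'"
    using inst_upd_sub[OF b''(1) c(2)] b''(2) c' All.IH by blast
  finally show ?case unfolding c'(1) using fvc c' by (intro ent_AllI) auto
next
  case (Ex x a)
  obtain z b where c: "c = Ex z b" "z \<notin> f ` (fv a - {x})" "inst (f(x := z)) a b"
    using Ex.prems by auto
  obtain z' b' where c': "c' = Ex z' b'" "z' \<notin> f ` (fv a - {x})" "inst (f(x := z')) a b'"
    using Ex.prems by auto
  obtain b'' where b'': "inst (f(x := z')) a b''" "bv b'' \<inter> {z} = {}"
    using inst_avoiding by (metis finite.emptyI finite.insertI)
  have fvc: "fv c' = f ` (fv a - {x})" using inst_fv[OF Ex.prems(2)] by simp
  have "b'' \<turnstile> b'" using Ex.IH c' b'' by blast
  also have "b' \<turnstile> c'" using ent_Ex[of z' z' b'] c' by simp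
  finally have "Ex z' b'' \<turnstile> c'" using fvc c' by (intro Ex_ent) auto
  moreover have "sub z' z b'' \<turnstile> Ex z' b''" using b'' by (intro ent_Ex freefor_bv) auto
  moreover have "b \<turnstile> sub z' z b''"
    using inst_upd_sub[OF b''(1) c'(2)] b''(2) c Ex.IH by blast
  ultimately have "b \<turnstile> c'" using ent_trans by blast
  then show ?case unfolding c(1) using fvc c by (intro Ex_ent) auto
next
  case (Conj a b)
  then show ?case by (auto intro!: Conj_ent_mono)
next
  case (Disj a b)
  then show ?case by (auto intro!: Disj_ent_mono)
next
  case (Imp a b)
  then show ?case by (auto intro!: Imp_ent_mono)
qed auto

subsection \<open>Forcing\<close>

text \<open>Forcing in the Kripke--Beth model whose worlds are formulas ordered by \<open>\<turnstile>\<close> and whose domain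
  is the set of variables; bound variables cannot clash in this semantics.\<close>

definition sat :: "fm \<Rightarrow> (nat \<Rightarrow> nat) \<Rightarrow> fm \<Rightarrow> bool" where
  "sat \<gamma> f a \<longleftrightarrow> (\<exists>c. inst f a c \<and> \<gamma> \<turnstile> c)"

lemma sat_inst: "inst f a c \<Longrightarrow> sat \<gamma> f a \<longleftrightarrow> \<gamma> \<turnstile> c"
  unfolding sat_def using inst_ent ent_trans by blast

lemma sat_id: "sat \<gamma> id a \<longleftrightarrow> \<gamma> \<turnstile> a"
  by (rule sat_inst) (rule inst_id)

lemma sat_Top: "sat \<gamma> f Top"
  by (simp add: sat_def)

lemma sat_Conj: "sat \<gamma> f (Conj a b) \<longleftrightarrow> sat \<gamma> f a \<and> sat \<gamma> f b"
  unfolding sat_def by (simp, metis ent_Conj)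

lemma sat_Imp: "sat \<gamma> f (Imp a b) \<longleftrightarrow> (\<forall>\<delta>. \<delta> \<turnstile> \<gamma> \<longrightarrow> sat \<delta> f a \<longrightarrow> sat \<delta> f b)"
proof
  show "sat \<gamma> f (Imp a b) \<Longrightarrow> \<forall>\<delta>. \<delta> \<turnstile> \<gamma> \<longrightarrow> sat \<delta> f a \<longrightarrow> sat \<delta> f b"
    by (auto simp: sat_def) (meson ent_trans inst_ent nd_S)
  assume R: "\<forall>\<delta>. \<delta> \<turnstile> \<gamma> \<longrightarrow> sat \<delta> f a \<longrightarrow> sat \<delta> f b"
  obtain a' where a': "inst f a a'" using inst_avoiding by (metis finite.emptyI)
  \<comment> \<open>\<open>Conj \<gamma> a'\<close> is the weakest world below
    \<open>\<gamma>\<close> that forces \<open>a\<close>, so testing there is enough.\<close>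
  have "sat (Conj \<gamma> a') f b"
    using R a' sat_inst Conj_ent1 Conj_ent2 by blast
  then show "sat \<gamma> f (Imp a b)" using a' by (simp add: sat_def, metis ent_Imp)
qed

lemma sat_All: "sat \<gamma> f (All x a) \<longleftrightarrow> (\<forall>y. sat \<gamma> (f(x := y)) a)"
proof
  assume L: "sat \<gamma> f (All x a)"
  show "\<forall>y. sat \<gamma> (f(x := y)) a"
  proof
    fix y
    obtain c where c: "inst f (All x a) c" "bv c \<inter> {y} = {}"
      using inst_avoiding by (metis finite.emptyI finite.insertI)
    then obtain z b where b: "c = All z b" "z \<notin> f ` (fv a - {x})" "inst (f(x := z)) a b" by auto
    have "\<gamma> \<turnstile> All z b" using L c(1) b(1) sat_inst by blast
    also have "All z b \<turnstile> sub z y b" using b c by (intro All_ent freefor_bv) auto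
    finally show "sat \<gamma> (f(x := y)) a"
      using inst_upd_sub[OF b(3,2), of y] c b by (auto simp: sat_def)
  qed
next
  assume R: "\<forall>y. sat \<gamma> (f(x := y)) a"
  \<comment> \<open>The binder of \<open>c\<close> avoids \<open>fv \<gamma>\<close>, so forcing
    \<open>a\<close> at this one generic value already permits generalization.\<close>
  obtain c where c: "inst f (All x a) c" "bv c \<inter> fv \<gamma> = {}"
    using inst_avoiding by (metis finite_fv)
  then obtain z b where b: "c = All z b" "z \<notin> f ` (fv a - {x})" "inst (f(x := z)) a b" by auto
  then have "\<gamma> \<turnstile> b" using R sat_inst by blast
  then have "\<gamma> \<turnstile> c" unfolding b(1) using c b by (intro ent_AllI) auto
  then show "sat \<gamma> f (All x a)" using c sat_def by blast
qed

lemma sat_ExI: "sat \<gamma> (f(x := y)) a \<Longrightarrow> sat \<gamma> f (Ex x a)"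
proof -
  assume L: "sat \<gamma> (f(x := y)) a"
  obtain c where c: "inst f (Ex x a) c" "bv c \<inter> {y} = {}"
    using inst_avoiding by (metis finite.emptyI finite.insertI)
  then obtain z b where b: "c = Ex z b" "z \<notin> f ` (fv a - {x})" "inst (f(x := z)) a b" by auto
  have "\<gamma> \<turnstile> sub z y b" using L inst_upd_sub[OF b(3,2), of y] c b sat_inst by auto
  also have "sub z y b \<turnstile> Ex z b" using b c by (intro ent_Ex freefor_bv) auto
  finally show ?thesis using c b by (auto simp: sat_def)
qed

text \<open>A world may entail an existential formula without entailing any instance, so there is no
  witness clause at \<open>\<gamma>\<close> itself. A witness is available only at stronger worlds
  and only while proving a fixed formula \<open>C\<close>.\<close>

lemma sat_ExE:
  assumes "sat \<gamma> f (Ex x a)" and C: "\<And>\<delta> y. \<delta> \<turnstile> \<gamma> \<Longrightarrow> sat \<delta> (f(x := y)) a \<Longrightarrow> \<delta> \<turnstile> C"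
  shows "\<gamma> \<turnstile> C"
proof -
  obtain c where c: "inst f (Ex x a) c" "bv c \<inter> (fv \<gamma> \<union> fv C) = {}"
    using inst_avoiding by (metis finite_fv finite_UnI)
  then obtain z b where b: "c = Ex z b" "z \<notin> f ` (fv a - {x})" "inst (f(x := z)) a b" by auto
  have "Conj \<gamma> b \<turnstile> C"
    using C[OF Conj_ent1] b(3) Conj_ent2 sat_inst by blast
  then have "Conj b \<gamma> \<turnstile> C"
    by (meson Conj_ent1 Conj_ent2 ent_Conj ent_trans)
  \<comment> \<open>\<open>Ex_ent\<close> has no side context, so \<open>\<gamma>\<close> is moved
    into the conclusion; \<open>z\<close> avoids both \<open>fv \<gamma>\<close> and
    \<open>fv C\<close>.\<close>
  then have "Ex z b \<turnstile> Imp \<gamma> C"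
    using c b by (intro Ex_ent) (auto simp: ent_Imp)
  moreover have "\<gamma> \<turnstile> Ex z b" using assms(1) c b sat_inst by blast
  ultimately show ?thesis using ent_trans nd_S ent_refl by blast
qed

lemma sat_foldr_All:
  "sat \<gamma> f (foldr All ys a) \<longleftrightarrow> (\<forall>f'. (\<forall>v. v \<notin> set ys \<longrightarrow> f' v = f v) \<longrightarrow> sat \<gamma> f' a)"
proof (induction ys arbitrary: f)
  case Nil
  then show ?case by (auto simp: fun_eq_iff[symmetric])
next
  case (Cons y ys)
  have "(\<exists>w. \<forall>v. v \<notin> set ys \<longrightarrow> f' v = (f(y := w)) v) \<longleftrightarrow> (\<forall>v. v \<notin> set (y # ys) \<longrightarrow> f' v = f v)"
    for f' by (auto intro!: exI[of _ "f' y"])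
  then show ?case by (simp add: sat_All Cons) metis
qed

lemma sat_foldr_ExI:
  "sat \<gamma> f' a \<Longrightarrow> (\<And>v. v \<notin> set ys \<Longrightarrow> f' v = f v) \<Longrightarrow> sat \<gamma> f (foldr Ex ys a)"
proof (induction ys arbitrary: f)
  case Nil
  then have "f' = f" by auto
  with Nil show ?case by simp
next
  case (Cons y ys)
  have "sat \<gamma> (f(y := f' y)) (foldr Ex ys a)"
    using Cons.prems by (intro Cons.IH) auto
  then show ?case by (auto intro: sat_ExI)
qed

lemma sat_foldr_ExE:
  assumes "sat \<gamma> f (foldr Ex ys a)"
    and "\<And>\<delta> f'. \<delta> \<turnstile> \<gamma> \<Longrightarrow> (\<And>v. v \<notin> set ys \<Longrightarrow> f' v = f v) \<Longrightarrow> sat \<delta> f' a \<Longrightarrow> \<delta> \<turnstile> C"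
  shows "\<gamma> \<turnstile> C"
  using assms
proof (induction ys arbitrary: \<gamma> f)
  case Nil
  then show ?case by simp
next
  case (Cons y ys)
  have "sat \<gamma> f (Ex y (foldr Ex ys a))" using Cons.prems by simp
  then show ?case
  proof (rule sat_ExE)
    fix \<delta> w assume *: "\<delta> \<turnstile> \<gamma>" "sat \<delta> (f(y := w)) (foldr Ex ys a)"
    show "\<delta> \<turnstile> C"
      using *(2)
    proof (rule Cons.IH)
      fix \<delta>' f'
      assume "\<delta>' \<turnstile> \<delta>" "\<And>v. v \<notin> set ys \<Longrightarrow> f' v = (f(y := w)) v" "sat \<delta>' f' a"
      then show "\<delta>' \<turnstile> C"
        using Cons.prems(2)[of \<delta>' f'] ent_trans[OF _ *(1)] by simp
    qed
  qed
qed

lemma sat_conjs: "sat \<gamma> f (conjs as) \<longleftrightarrow> (\<forall>a\<in>set as. sat \<gamma> f a)"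
  by (induction as rule: conjs.induct) (auto simp: sat_Top sat_Conj)

subsection \<open>Forcing of translated types\<close>

lemma pos_nth: "distinct u \<Longrightarrow> i < length u \<Longrightarrow> pos u (u ! i) = i"
proof (induction u arbitrary: i)
  case (Cons a u)
  then show ?case by (cases i) (auto simp: pos_def)
qed simp

lemma pos_less: "v \<in> set u \<Longrightarrow> pos u v < length u"
  unfolding pos_def by (induction u) auto

lemma nth_pos: "v \<in> set u \<Longrightarrow> u ! pos u v = v"
  unfolding pos_def by (induction u) auto

lemma length_filter_upt_less:
  assumes "v < w" "P v"
  shows "length (filter P [0..<v]) < length (filter P [0..<w])"
proof -
  have "[0..<w] = [0..<v] @ v # [Suc v..<w]"
    using assms(1) upt_add_eq_append[of 0 v "w - v"] upt_conv_Cons[of v w] by simp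
  then show ?thesis using assms(2) by simp
qed

text \<open>Counting the earlier elements of \<open>P\<close> numbers \<open>P\<close> in strictly
  increasing order. This count underlies both the fresh variables of \<open>vassign\<close> and the
  fresh nodes of \<open>irank\<close>.\<close>

lemma inj_on_length_filter_upt: "inj_on (\<lambda>v. length (filter P [0..<v])) {v. P v}"
  by (rule linorder_inj_onI') (metis length_filter_upt_less less_irrefl mem_Collect_eq)

lemma map_vassign:
  assumes "distinct u" "length xs = length u"
  shows "map (vassign u xs) u = xs"
  using assms by (auto intro: nth_equalityI simp: vassign_def pos_nth)

lemma vassign_outside: "v \<notin> set u \<Longrightarrow> vassign u xs v \<notin> set xs"
proof -
  have "z \<in> set xs \<Longrightarrow> z \<le> Max (insert 0 (set xs))" for z by simp
  moreover assume "v \<notin> set u"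
  ultimately show ?thesis unfolding vassign_def by fastforce
qed

lemma inj_on_vassign: "inj_on (vassign u xs) (- set u)"
  using inj_on_length_filter_upt[of "\<lambda>w. w \<notin> set u"] by (auto simp: inj_on_def vassign_def)

abbreviation bound_vars :: "nat list \<Rightarrow> nat list \<Rightarrow> nat \<Rightarrow> nat list" where
  "bound_vars u xs n \<equiv> map (vassign u xs) (fresh_nodes u n)"

lemma bound_vars_disjoint: "v \<in> set xs \<Longrightarrow> v \<notin> set (bound_vars u xs n)"
  using vassign_outside by (auto simp: fresh_nodes_def)

lemma vassign_comp:
  assumes "distinct u" "length xs = length u"
    and "\<And>v. v \<notin> set (bound_vars u xs n) \<Longrightarrow> f' v = f v"
  shows "map (f' \<circ> vassign u xs) u = map f xs"
proof -
  have "map (f' \<circ> vassign u xs) u = map f' (map (vassign u xs) u)" by simp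
  also have "\<dots> = map f' xs" using assms(1,2) by (simp only: map_vassign)
  also have "\<dots> = map f xs" using assms(3) bound_vars_disjoint by (metis map_cong)
  finally show ?thesis .
qed

text \<open>Converse of \<open>vassign_comp\<close>: every node assignment with the right values on
  \<open>u\<close> comes from changing \<open>f\<close> on the bound variables alone. Entries of
  \<open>xs\<close> may coincide, so \<open>vassign\<close> is inverted only outside
  \<open>u\<close>, where it is injective; on \<open>u\<close> the third assumption supplies the
  agreement.\<close>

lemma vassign_factor:
  assumes "distinct u" "length xs = length u" "map g u = map f xs"
  obtains f' where "\<And>v. v \<notin> set (bound_vars u xs n) \<Longrightarrow> f' v = f v"
    and "\<And>v. v < n \<Longrightarrow> f' (vassign u xs v) = g v"
proof
  define f' where "f' = (\<lambda>w. if w \<in> set (bound_vars u xs n)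
    then g (the_inv_into (- set u) (vassign u xs) w) else f w)"
  show "f' v = f v" if "v \<notin> set (bound_vars u xs n)" for v
    using that by (simp add: f'_def)
  show "f' (vassign u xs v) = g v" if "v < n" for v
  proof (cases "v \<in> set u")
    case True
    then have i: "pos u v < length u" "u ! pos u v = v" by (auto simp: pos_less nth_pos)
    then have "vassign u xs v = xs ! pos u v" using True by (simp add: vassign_def)
    moreover from this have "vassign u xs v \<notin> set (bound_vars u xs n)"
      using i assms(2) by (intro bound_vars_disjoint) simp
    moreover have "f (xs ! pos u v) = g v"
      using i assms(2,3) by (metis nth_map)
    ultimately show ?thesis by (simp add: f'_def)
  next
    case False
    then have "vassign u xs v \<in> set (bound_vars u xs n)"
      using that by (auto simp: fresh_nodes_def)
    then show ?thesis using False by (simp add: f'_def the_inv_into_f_f inj_on_vassign)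
  qed
qed

text \<open>Compatibility of the components with renaming enters as the hypotheses \<open>N\<close>
  and \<open>T\<close>, because the clause serves both inside the induction that proves this
  compatibility (\<open>sat_tr\<close>) and after it (\<open>ent_tr_Div\<close>).\<close>

lemma sat_Div:
  assumes D: "wf_graph D" "distinct (dollar_att D)" "length xs = length (dollar_att D)"
    and N: "\<And>\<gamma> f ys. length ys = length (ext D) \<Longrightarrow> sat \<gamma> f (tr N ys) \<longleftrightarrow> \<gamma> \<turnstile> tr N (map f ys)"
    and T: "\<And>T a \<gamma> f ys. (Some T, a) \<in> set (edges D) \<Longrightarrow> length ys = length a \<Longrightarrow>
      sat \<gamma> f (tr T ys) \<longleftrightarrow> \<gamma> \<turnstile> tr T (map f ys)"
  shows "sat \<gamma> f (tr (Div N D) xs) \<longleftrightarrow>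
    (\<forall>\<delta> g. \<delta> \<turnstile> \<gamma> \<longrightarrow> map g (dollar_att D) = map f xs \<longrightarrow>
      (\<forall>T a. (Some T, a) \<in> set (edges D) \<longrightarrow> \<delta> \<turnstile> tr T (map g a)) \<longrightarrow> \<delta> \<turnstile> tr N (map g (ext D)))"
    (is "_ \<longleftrightarrow> ?R")
proof -
  let ?va = "vassign (dollar_att D) xs" and ?ys = "bound_vars (dollar_att D) xs (nverts D)"
  let ?P = "\<lambda>\<delta> g. (\<forall>T a. (Some T, a) \<in> set (edges D) \<longrightarrow> \<delta> \<turnstile> tr T (map g a)) \<longrightarrow>
    \<delta> \<turnstile> tr N (map g (ext D))"
  have "sat \<delta> f' (conjs (concat (map (\<lambda>(l,a). case l of None \<Rightarrow> []
      | Some T \<Rightarrow> [tr T (map ?va a)]) (edges D)))) \<longleftrightarrow>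
      (\<forall>T a. (Some T, a) \<in> set (edges D) \<longrightarrow> sat \<delta> f' (tr T (map ?va a)))" for \<delta> f'
    by (fastforce simp: sat_conjs split: option.splits)
  then have "sat \<gamma> f (tr (Div N D) xs) \<longleftrightarrow>
    (\<forall>f'. (\<forall>v. v \<notin> set ?ys \<longrightarrow> f' v = f v) \<longrightarrow> (\<forall>\<delta>. \<delta> \<turnstile> \<gamma> \<longrightarrow> ?P \<delta> (f' \<circ> ?va)))"
    using N T by (simp add: sat_foldr_All sat_Imp del: map_map map_comp_map) (simp add: comp_def)
  also have "\<dots> \<longleftrightarrow> (\<forall>\<delta> g. \<delta> \<turnstile> \<gamma> \<longrightarrow> map g (dollar_att D) = map f xs \<longrightarrow> ?P \<delta> g)"
  proof (intro iffI allI impI, goal_cases)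
    case (1 \<delta> g)
    obtain f' where f': "\<And>v. v \<notin> set ?ys \<Longrightarrow> f' v = f v"
      "\<And>v. v < nverts D \<Longrightarrow> f' (?va v) = g v"
      using vassign_factor[OF D(2,3) 1(3)] by metis
    have eq: "map (f' \<circ> ?va) a = map g a" if "set a \<subseteq> {..<nverts D}" for a
      using that f'(2) by auto
    have "map (f' \<circ> ?va) a = map g a" if "(l, a) \<in> set (edges D)" for l a
      using that D(1) by (intro eq) (auto simp: wf_graph_def)
    moreover have "map (f' \<circ> ?va) (ext D) = map g (ext D)"
      using D(1) by (intro eq) (auto simp: wf_graph_def)
    ultimately show ?case using 1 f'(1) by metis
  next
    case (2 f' \<delta>)
    then show ?case using vassign_comp[OF D(2,3), of "nverts D" f' f] by blast
  qed
  finally show ?thesis by blast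
qed

lemma sat_Times:
  assumes M: "wf_graph M" "length xs = length (ext M)"
    and T: "\<And>T a \<gamma> f ys. (T, a) \<in> set (edges M) \<Longrightarrow> length ys = length a \<Longrightarrow>
      sat \<gamma> f (tr T ys) \<longleftrightarrow> \<gamma> \<turnstile> tr T (map f ys)"
  shows "sat \<gamma> f (tr (Times M) xs) \<longleftrightarrow>
    (\<forall>C. (\<forall>\<delta> g. \<delta> \<turnstile> \<gamma> \<longrightarrow> map g (ext M) = map f xs \<longrightarrow>
      (\<forall>T a. (T, a) \<in> set (edges M) \<longrightarrow> \<delta> \<turnstile> tr T (map g a)) \<longrightarrow> \<delta> \<turnstile> C) \<longrightarrow> \<gamma> \<turnstile> C)"
    (is "?L \<longleftrightarrow> ?R")
proof -
  let ?va = "vassign (ext M) xs" and ?ys = "bound_vars (ext M) xs (nverts M)"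
  let ?c = "conjs (map (\<lambda>(T,a). tr T (map ?va a)) (edges M))"
  have d: "distinct (ext M)" using M(1) by (simp add: wf_graph_def)
  have c: "sat \<delta> f' ?c \<longleftrightarrow> (\<forall>T a. (T, a) \<in> set (edges M) \<longrightarrow> \<delta> \<turnstile> tr T (map (f' \<circ> ?va) a))"
    for \<delta> f' using T by (fastforce simp: sat_conjs)
  show ?thesis
  proof (intro iffI allI impI)
    fix C
    assume L: ?L and H: "\<forall>\<delta> g. \<delta> \<turnstile> \<gamma> \<longrightarrow> map g (ext M) = map f xs \<longrightarrow>
      (\<forall>T a. (T, a) \<in> set (edges M) \<longrightarrow> \<delta> \<turnstile> tr T (map g a)) \<longrightarrow> \<delta> \<turnstile> C"
    from L have "sat \<gamma> f (foldr Ex ?ys ?c)" by simp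
    then show "\<gamma> \<turnstile> C"
    proof (rule sat_foldr_ExE)
      fix \<delta> f'
      assume "\<delta> \<turnstile> \<gamma>" "\<And>v. v \<notin> set ?ys \<Longrightarrow> f' v = f v" "sat \<delta> f' ?c"
      then show "\<delta> \<turnstile> C" using H vassign_comp[OF d M(2), of "nverts M" f' f] c by blast
    qed
  next
    assume R: ?R
    \<comment> \<open>The arbitrary conclusion is instantiated with the translated formula itself,
      renamed along \<open>f\<close>; every witness yields it by existential introduction.\<close>
    obtain C where C: "inst f (tr (Times M) xs) C"
      using inst_avoiding by (metis finite.emptyI)
    have "\<delta> \<turnstile> C" if "\<delta> \<turnstile> \<gamma>" and e: "map g (ext M) = map f xs"
      and g: "\<forall>T a. (T, a) \<in> set (edges M) \<longrightarrow> \<delta> \<turnstile> tr T (map g a)" for \<delta> g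
    proof -
      obtain f' where f': "\<And>v. v \<notin> set ?ys \<Longrightarrow> f' v = f v"
        "\<And>v. v < nverts M \<Longrightarrow> f' (?va v) = g v"
        using vassign_factor[OF d M(2) e] by metis
      have "map (f' \<circ> ?va) a = map g a" if "(T, a) \<in> set (edges M)" for T a
        using that f'(2) M(1) by (fastforce simp: wf_graph_def)
      then have "sat \<delta> f' ?c" using c g by metis
      then have "sat \<delta> f (foldr Ex ?ys ?c)" using f'(1) by (rule sat_foldr_ExI)
      then have "sat \<delta> f (tr (Times M) xs)" by simp
      then show ?thesis using sat_inst[OF C] by blast
    qed
    then show ?L using R sat_inst[OF C] by blast
  qed
qed

lemma dollar_att_cases:
  obtains "dollar_att D = []" | "(None, dollar_att D) \<in> set (edges D)"
proof (cases "find (\<lambda>(l,a). l = None) (edges D)")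
  case None
  then show thesis using that(1) by (simp add: dollar_att_def)
next
  case (Some e)
  then have "e \<in> set (edges D)" "fst e = None"
    by (auto simp: find_Some_iff) (metis nth_mem)
  moreover have "dollar_att D = snd e"
    using Some by (simp add: dollar_att_def case_prod_unfold)
  ultimately show thesis using that(2) by (metis prod.collapse)
qed

lemma distinct_dollar_att: "wf_graph D \<Longrightarrow> distinct (dollar_att D)"
  by (rule dollar_att_cases[of D]) (auto simp: wf_graph_def)

text \<open>The bound variables chosen for \<open>xs\<close> and for \<open>map f xs\<close> may
  differ, but the forcing clauses mention the arguments only through \<open>map f xs\<close>. Hence
  the clause for \<open>f\<close> and \<open>xs\<close> and the clause for \<open>id\<close> and
  \<open>map f xs\<close> have the same right-hand side.\<close>

lemma sat_tr: "wf_tp T \<Longrightarrow> length xs = arity T \<Longrightarrow> sat \<gamma> f (tr T xs) \<longleftrightarrow> \<gamma> \<turnstile> tr T (map f xs)"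
proof (induction T arbitrary: \<gamma> f xs rule: wf_tp.induct)
  case (1 p k)
  then show ?case by (simp add: sat_def)
next
  case (2 N D)
  note D = sat_Div[OF 2(2) distinct_dollar_att[OF 2(2)], of _ N]
  have "sat \<gamma>' f' (tr (Div N D) ys) \<longleftrightarrow>
    (\<forall>\<delta> g. \<delta> \<turnstile> \<gamma>' \<longrightarrow> map g (dollar_att D) = map f' ys \<longrightarrow>
      (\<forall>T a. (Some T, a) \<in> set (edges D) \<longrightarrow> \<delta> \<turnstile> tr T (map g a)) \<longrightarrow> \<delta> \<turnstile> tr N (map g (ext D)))"
    if "length ys = arity (Div N D)" for \<gamma>' f' ys
    using that 2 by (intro D) auto
  from this[of xs \<gamma> f] this[of "map f xs" \<gamma> id] "2.prems"
  show ?case by (simp add: sat_id del: tr.simps)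
next
  case (3 M)
  have "sat \<gamma>' f' (tr (Times M) ys) \<longleftrightarrow>
    (\<forall>C. (\<forall>\<delta> g. \<delta> \<turnstile> \<gamma>' \<longrightarrow> map g (ext M) = map f' ys \<longrightarrow>
      (\<forall>T a. (T, a) \<in> set (edges M) \<longrightarrow> \<delta> \<turnstile> tr T (map g a)) \<longrightarrow> \<delta> \<turnstile> C) \<longrightarrow> \<gamma>' \<turnstile> C)"
    if "length ys = arity (Times M)" for \<gamma>' f' ys
    using that 3 by (intro sat_Times) auto
  from this[of xs \<gamma> f] this[of "map f xs" \<gamma> id] "3.prems"
  show ?case by (simp add: sat_id del: tr.simps)
qed

inductive_cases wf_tp_DivE: "wf_tp (Div N D)"
inductive_cases wf_tp_TimesE: "wf_tp (Times M)"

lemma ent_tr_Div: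
  assumes "wf_tp (Div N D)" "length xs = arity (Div N D)"
  shows "\<gamma> \<turnstile> tr (Div N D) xs \<longleftrightarrow>
    (\<forall>\<delta> g. \<delta> \<turnstile> \<gamma> \<longrightarrow> map g (dollar_att D) = xs \<longrightarrow>
      (\<forall>T a. (Some T, a) \<in> set (edges D) \<longrightarrow> \<delta> \<turnstile> tr T (map g a)) \<longrightarrow> \<delta> \<turnstile> tr N (map g (ext D)))"
proof -
  have "sat \<gamma> id (tr (Div N D) xs) \<longleftrightarrow>
    (\<forall>\<delta> g. \<delta> \<turnstile> \<gamma> \<longrightarrow> map g (dollar_att D) = map id xs \<longrightarrow>
      (\<forall>T a. (Some T, a) \<in> set (edges D) \<longrightarrow> \<delta> \<turnstile> tr T (map g a)) \<longrightarrow> \<delta> \<turnstile> tr N (map g (ext D)))"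
    using assms by (elim wf_tp_DivE, intro sat_Div) (auto simp: distinct_dollar_att sat_tr simp del: tr.simps)
  then show ?thesis by (simp add: sat_id del: tr.simps)
qed

text \<open>Quantifying over the conclusion \<open>C\<close> is the impredicative encoding of the existential.\<close>

lemma ent_tr_Times:
  assumes "wf_tp (Times M)" "length xs = arity (Times M)"
  shows "\<gamma> \<turnstile> tr (Times M) xs \<longleftrightarrow>
    (\<forall>C. (\<forall>\<delta> g. \<delta> \<turnstile> \<gamma> \<longrightarrow> map g (ext M) = xs \<longrightarrow>
      (\<forall>T a. (T, a) \<in> set (edges M) \<longrightarrow> \<delta> \<turnstile> tr T (map g a)) \<longrightarrow> \<delta> \<turnstile> C) \<longrightarrow> \<gamma> \<turnstile> C)"
proof -
  have "sat \<gamma> id (tr (Times M) xs) \<longleftrightarrow>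
    (\<forall>C. (\<forall>\<delta> g. \<delta> \<turnstile> \<gamma> \<longrightarrow> map g (ext M) = map id xs \<longrightarrow>
      (\<forall>T a. (T, a) \<in> set (edges M) \<longrightarrow> \<delta> \<turnstile> tr T (map g a)) \<longrightarrow> \<delta> \<turnstile> C) \<longrightarrow> \<gamma> \<turnstile> C)"
    using assms by (elim wf_tp_TimesE, intro sat_Times) (auto simp: sat_tr simp del: tr.simps)
  then show ?thesis by (simp add: sat_id del: tr.simps)
qed

abbreviation edges_hold :: "fm \<Rightarrow> (nat \<Rightarrow> nat) \<Rightarrow> (tp \<times> nat list) list \<Rightarrow> bool" where
  "edges_hold \<gamma> g es \<equiv> \<forall>T a. (T, a) \<in> set es \<longrightarrow> \<gamma> \<turnstile> tr T (map g a)"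

subsection \<open>Equality of types up to graph isomorphism\<close>

lemma length_filter_eq_1_unique:
  assumes "length (filter P xs) = 1" "i < length xs" "j < length xs" "P (xs ! i)" "P (xs ! j)"
  shows "i = j"
proof -
  have "card {i. i < length xs \<and> P (xs ! i)} = 1"
    using assms(1) by (simp add: length_filter_conv_card)
  then obtain k where k: "{i. i < length xs \<and> P (xs ! i)} = {k}" by (rule card_1_singletonE)
  have "i \<in> {k}" "j \<in> {k}" unfolding k[symmetric] using assms(2-5) by simp_all
  then show ?thesis by simp
qed

lemma dollar_att_eqI:
  assumes "length (filter (\<lambda>(l,a). l = None) (edges D)) = 1" "(None, a) \<in> set (edges D)"
  shows "dollar_att D = a"
proof -
  obtain e where e: "filter (\<lambda>(l,a). l = None) (edges D) = [e]"
    using assms(1) by (auto simp: length_Suc_conv)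
  then have s: "set (filter (\<lambda>(l,a). l = None) (edges D)) = {e}" by simp
  have "b = a" if "(None, b) \<in> set (edges D)" for b
  proof -
    have "(None, b) \<in> {e}" "(None, a) \<in> {e}"
      unfolding s[symmetric] using that assms(2) by simp_all
    then show ?thesis by (metis singletonD snd_conv)
  qed
  moreover obtain b where "find (\<lambda>(l,a). l = None) (edges D) = Some (None, b)"
    "(None, b) \<in> set (edges D)"
  proof (cases "find (\<lambda>(l,a). l = None) (edges D)")
    case None
    then show ?thesis using assms(2) by (auto simp: find_None_iff)
  next
    case (Some e)
    then have "fst e = None" "e \<in> set (edges D)"
      by (auto simp: find_Some_iff) (metis nth_mem)
    then show ?thesis using that Some by (metis prod.collapse)
  qed
  ultimately show ?thesis by (simp add: dollar_att_def)
qed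

text \<open>The edge bijection is weakened to a matching in both directions, since the forcing
  clauses see edges only through membership. Multiplicity matters just for the uniqueness of the
  \<open>None\<close> label, which \<open>giso_length_filter\<close> transports.\<close>

lemma gisoE:
  assumes "giso R G G'"
  obtains \<pi> where "bij_betw \<pi> {..<nverts G} {..<nverts G'}" "ext G' = map \<pi> (ext G)"
    "\<And>l a. (l, a) \<in> set (edges G) \<Longrightarrow> \<exists>l'. R l l' \<and> (l', map \<pi> a) \<in> set (edges G')"
    "\<And>l' a'. (l', a') \<in> set (edges G') \<Longrightarrow> \<exists>l a. R l l' \<and> (l, a) \<in> set (edges G) \<and> a' = map \<pi> a"
proof -
  obtain \<pi> \<sigma> where \<pi>: "bij_betw \<pi> {..<nverts G} {..<nverts G'}" "ext G' = map \<pi> (ext G)"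
    and \<sigma>: "bij_betw \<sigma> {..<length (edges G)} {..<length (edges G')}"
    and e: "\<forall>i<length (edges G). R (fst (edges G ! i)) (fst (edges G' ! \<sigma> i)) \<and>
      snd (edges G' ! \<sigma> i) = map \<pi> (snd (edges G ! i))"
    using assms unfolding giso_def by blast
  show thesis
  proof (rule that[OF \<pi>])
    fix l a assume "(l, a) \<in> set (edges G)"
    then obtain i where i: "i < length (edges G)" "edges G ! i = (l, a)"
      by (auto simp: in_set_conv_nth)
    then have "edges G' ! \<sigma> i \<in> set (edges G')" using \<sigma> bij_betwE by fastforce
    then show "\<exists>l'. R l l' \<and> (l', map \<pi> a) \<in> set (edges G')"
      using e i by (metis fst_conv snd_conv prod.collapse)
  next
    fix l' a' assume "(l', a') \<in> set (edges G')"
    then obtain j where j: "j < length (edges G')" "edges G' ! j = (l', a')"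
      by (auto simp: in_set_conv_nth)
    then obtain i where i: "i < length (edges G)" "j = \<sigma> i"
      using \<sigma> by (auto simp: bij_betw_def image_def set_eq_iff)
    then show "\<exists>l a. R l l' \<and> (l, a) \<in> set (edges G) \<and> a' = map \<pi> a"
      using e j by (metis fst_conv snd_conv prod.collapse nth_mem)
  qed
qed

lemma giso_length_filter:
  assumes "giso R G G'" "\<And>l l'. R l l' \<Longrightarrow> P l \<longleftrightarrow> Q l'"
  shows "length (filter (\<lambda>(l,a). P l) (edges G)) = length (filter (\<lambda>(l,a). Q l) (edges G'))"
proof -
  obtain \<sigma> where \<sigma>: "bij_betw \<sigma> {..<length (edges G)} {..<length (edges G')}"
    and e: "\<forall>i<length (edges G). R (fst (edges G ! i)) (fst (edges G' ! \<sigma> i))"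
    using assms(1) unfolding giso_def by blast
  have "bij_betw \<sigma> {i. i < length (edges G) \<and> P (fst (edges G ! i))}
      {i. i < length (edges G') \<and> Q (fst (edges G' ! i))}"
    unfolding bij_betw_def
  proof
    show "inj_on \<sigma> {i. i < length (edges G) \<and> P (fst (edges G ! i))}"
      using \<sigma> by (auto simp: bij_betw_def inj_on_def)
    have "\<sigma> ` {..<length (edges G)} = {..<length (edges G')}"
      using \<sigma> by (simp add: bij_betw_def)
    moreover have "P (fst (edges G ! i)) \<longleftrightarrow> Q (fst (edges G' ! \<sigma> i))"
      if "i < length (edges G)" for i
      using that e assms(2) by blast
    ultimately show "\<sigma> ` {i. i < length (edges G) \<and> P (fst (edges G ! i))} =
        {i. i < length (edges G') \<and> Q (fst (edges G' ! i))}"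
      by (smt (verit, ccfv_SIG) Collect_cong Setcompr_eq_image imageE imageI lessThan_iff
          mem_Collect_eq set_eq_iff)
  qed
  then show ?thesis
    by (simp add: length_filter_conv_card case_prod_unfold bij_betw_same_card)
qed

lemma giso_wf_graph:
  assumes "giso R G G'" "wf_graph G"
  shows "wf_graph G'"
proof -
  obtain \<pi> where \<pi>: "bij_betw \<pi> {..<nverts G} {..<nverts G'}" "ext G' = map \<pi> (ext G)"
    "\<And>l' a'. (l', a') \<in> set (edges G') \<Longrightarrow> \<exists>l a. R l l' \<and> (l, a) \<in> set (edges G) \<and> a' = map \<pi> a"
    using gisoE[OF assms(1)] by metis
  have m: "distinct (map \<pi> a) \<and> set (map \<pi> a) \<subseteq> {..<nverts G'}"
    if "distinct a" "set a \<subseteq> {..<nverts G}" for a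
    using that \<pi>(1) by (auto simp: bij_betw_def distinct_map intro: inj_on_subset)
  have "distinct a' \<and> set a' \<subseteq> {..<nverts G'}" if e: "(l', a') \<in> set (edges G')" for l' a'
  proof -
    obtain l a where a: "(l, a) \<in> set (edges G)" "a' = map \<pi> a" using \<pi>(3)[OF e] by blast
    then have "distinct a" "set a \<subseteq> {..<nverts G}" using assms(2) by (auto simp: wf_graph_def)
    then show ?thesis using m a(2) by blast
  qed
  moreover have "distinct (ext G') \<and> set (ext G') \<subseteq> {..<nverts G'}"
    using m[of "ext G"] assms(2) \<pi>(2) by (simp add: wf_graph_def)
  ultimately show ?thesis by (auto simp: wf_graph_def)
qed

text \<open>An assignment \<open>g\<close> on \<open>D'\<close> pulls back to
  \<open>g \<circ> \<pi>\<close> on \<open>D\<close>. The form with a mere map of nodes applies to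
  an isomorphism and to its inverse alike; edge labels vary contravariantly, the numerator
  covariantly.\<close>

lemma tr_Div_hom:
  assumes wf: "wf_tp (Div N D)" "wf_tp (Div N' D')" "length xs = arity (Div N D)"
    and \<pi>: "ext D' = map \<pi> (ext D)" "dollar_att D' = map \<pi> (dollar_att D)"
    and e: "\<And>T a. (Some T, a) \<in> set (edges D) \<Longrightarrow> \<exists>T'. (Some T', map \<pi> a) \<in> set (edges D') \<and>
      (\<forall>\<delta> ys. length ys = length a \<longrightarrow> \<delta> \<turnstile> tr T' ys \<longrightarrow> \<delta> \<turnstile> tr T ys)"
    and N: "\<And>\<delta> ys. length ys = length (ext D) \<Longrightarrow> \<delta> \<turnstile> tr N ys \<Longrightarrow> \<delta> \<turnstile> tr N' ys"
    and D: "\<gamma> \<turnstile> tr (Div N D) xs"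
  shows "\<gamma> \<turnstile> tr (Div N' D') xs"
proof -
  have "\<delta> \<turnstile> tr N' (map g (ext D'))"
    if "\<delta> \<turnstile> \<gamma>" "map g (dollar_att D') = xs"
      and g: "\<forall>T a. (Some T, a) \<in> set (edges D') \<longrightarrow> \<delta> \<turnstile> tr T (map g a)" for \<delta> g
  proof -
    have "\<delta> \<turnstile> tr T (map (g \<circ> \<pi>) a)" if "(Some T, a) \<in> set (edges D)" for T a
    proof -
      obtain T' where "(Some T', map \<pi> a) \<in> set (edges D')"
        "\<And>\<delta> ys. length ys = length a \<Longrightarrow> \<delta> \<turnstile> tr T' ys \<Longrightarrow> \<delta> \<turnstile> tr T ys"
        using e[OF \<open>(Some T, a) \<in> set (edges D)\<close>] by blast
      then show ?thesis using g by fastforce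
    qed
    then have "\<delta> \<turnstile> tr N (map (g \<circ> \<pi>) (ext D))"
      using D that(1,2) \<pi>(2) unfolding ent_tr_Div[OF wf(1,3)] by auto
    then show ?thesis using N[of "map (g \<circ> \<pi>) (ext D)"] \<pi>(1) by simp
  qed
  then show ?thesis
    using wf(2,3) \<pi>(2) by (simp add: ent_tr_Div del: tr.simps)
qed

text \<open>Pulling back turns witnesses for \<open>M'\<close> into witnesses for \<open>M\<close>,
  so the entailment runs against the direction of \<open>\<pi>\<close>.\<close>

lemma tr_Times_hom:
  assumes wf: "wf_tp (Times M)" "wf_tp (Times M')" "length xs = arity (Times M)"
    and \<pi>: "ext M' = map \<pi> (ext M)"
    and e: "\<And>T a. (T, a) \<in> set (edges M) \<Longrightarrow> \<exists>T'. (T', map \<pi> a) \<in> set (edges M') \<and>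
      (\<forall>\<delta> ys. length ys = length a \<longrightarrow> \<delta> \<turnstile> tr T' ys \<longrightarrow> \<delta> \<turnstile> tr T ys)"
    and M: "\<gamma> \<turnstile> tr (Times M') xs"
  shows "\<gamma> \<turnstile> tr (Times M) xs"
proof -
  have "\<gamma> \<turnstile> C" if C: "\<forall>\<delta> g. \<delta> \<turnstile> \<gamma> \<longrightarrow> map g (ext M) = xs \<longrightarrow> edges_hold \<delta> g (edges M) \<longrightarrow> \<delta> \<turnstile> C"
    for C
  proof -
    have "\<delta> \<turnstile> C" if "\<delta> \<turnstile> \<gamma>" "map g (ext M') = xs" and g: "edges_hold \<delta> g (edges M')" for \<delta> g
    proof -
      have "\<delta> \<turnstile> tr T (map (g \<circ> \<pi>) a)" if "(T, a) \<in> set (edges M)" for T a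
      proof -
        obtain T' where "(T', map \<pi> a) \<in> set (edges M')"
          "\<And>\<delta> ys. length ys = length a \<Longrightarrow> \<delta> \<turnstile> tr T' ys \<Longrightarrow> \<delta> \<turnstile> tr T ys"
          using e[OF \<open>(T, a) \<in> set (edges M)\<close>] by blast
        then show ?thesis using g by fastforce
      qed
      moreover have "map (g \<circ> \<pi>) (ext M) = xs" using that(2) \<pi> by simp
      ultimately show ?thesis using C that(1) by blast
    qed
    then show ?thesis
      using M wf(2,3) \<pi> by (simp add: ent_tr_Times del: tr.simps)
  qed
  then show ?thesis using wf by (simp add: ent_tr_Times del: tr.simps)
qed

section \<open>Invariance of typing and meaning under \<open>teq\<close>\<close>

lemma map_inv_into_map:
  "bij_betw \<pi> A B \<Longrightarrow> set a \<subseteq> A \<Longrightarrow> map (inv_into A \<pi>) (map \<pi> a) = a"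
  by (auto simp: bij_betw_def intro!: map_idI)

text \<open>\<open>teq\<close> says nothing about well-formedness, so \<open>wf_tp A'\<close> is
  transported along with the meaning; the forcing clauses for \<open>A'\<close> depend on
  it.\<close>

definition tp_equiv :: "tp \<Rightarrow> tp \<Rightarrow> bool" where
  "tp_equiv A A' \<longleftrightarrow> arity A' = arity A \<and> wf_tp A' \<and>
     (\<forall>\<gamma> xs. length xs = arity A \<longrightarrow> \<gamma> \<turnstile> tr A xs \<longleftrightarrow> \<gamma> \<turnstile> tr A' xs)"

lemma teq_tp_equiv: "teq A A' \<Longrightarrow> wf_tp A \<Longrightarrow> tp_equiv A A'"
proof (induction rule: teq.induct)
  case (1 p k)
  then show ?case by (simp add: tp_equiv_def)
next
  case (2 N N' D D')
  from \<open>wf_tp (Div N D)\<close> have wf: "wf_tp N" "wf_graph D"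
    "length (filter (\<lambda>(l,a). l = None) (edges D)) = 1"
    "\<And>T a. (Some T, a) \<in> set (edges D) \<Longrightarrow> wf_tp T \<and> arity T = length a"
    "arity N = length (ext D)"
    by (auto elim: wf_tp_DivE)
  have N: "tp_equiv N N'" using 2 wf(1) by blast
  \<comment> \<open>The induction rule of \<open>teq\<close> places its hypothesis under
    \<open>giso\<close>; \<open>R\<close> names the strengthened label relation so that
    \<open>gisoE\<close> can be applied to it.\<close>
  define R where "R = rel_option (\<lambda>x y. teq x y \<and> (wf_tp x \<longrightarrow> tp_equiv x y))"
  have iso: "giso R D D'" using 2 by (simp add: R_def)
  obtain \<pi> where \<pi>: "bij_betw \<pi> {..<nverts D} {..<nverts D'}" "ext D' = map \<pi> (ext D)"
    and e: "\<And>l a. (l, a) \<in> set (edges D) \<Longrightarrow> \<exists>l'. R l l' \<and> (l', map \<pi> a) \<in> set (edges D')"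
    and e': "\<And>l' a'. (l', a') \<in> set (edges D') \<Longrightarrow>
      \<exists>l a. R l l' \<and> (l, a) \<in> set (edges D) \<and> a' = map \<pi> a"
    using gisoE[OF iso] by metis
  have None: "length (filter (\<lambda>(l,a). l = None) (edges D')) = 1"
    using giso_length_filter[OF iso, of "\<lambda>l. l = None" "\<lambda>l. l = None"] wf(3)
    by (auto simp: R_def option.rel_sel)
  have "\<exists>a. (None, a) \<in> set (edges D)"
    using wf(3) by (metis (mono_tags, lifting) One_nat_def case_prodE filter_False length_0_conv n_not_Suc_n)
  then have "(None, dollar_att D) \<in> set (edges D)" using dollar_att_eqI[OF wf(3)] by blast
  then have "(None, map \<pi> (dollar_att D)) \<in> set (edges D')"
    using e by (fastforce simp: R_def)
  then have d': "dollar_att D' = map \<pi> (dollar_att D)" by (rule dollar_att_eqI[OF None])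
  have E: "\<exists>T'. (Some T', map \<pi> a) \<in> set (edges D') \<and> tp_equiv T T' \<and> arity T = length a"
    if "(Some T, a) \<in> set (edges D)" for T a
    using e[OF that] wf(4)[OF that] by (auto simp: R_def option_rel_Some1)
  have E': "\<exists>T a. (Some T, a) \<in> set (edges D) \<and> a' = map \<pi> a \<and> tp_equiv T T' \<and> arity T = length a"
    if "(Some T', a') \<in> set (edges D')" for T' a'
    using e'[OF that] wf(4) by (fastforce simp: R_def option_rel_Some2)
  have wf': "wf_tp (Div N' D')"
  proof (rule wf_tp.intros)
    show "wf_tp N'" "arity N' = length (ext D')"
      using N wf(5) \<pi>(2) by (auto simp: tp_equiv_def)
    show "wf_graph D'" using giso_wf_graph[OF iso wf(2)] .
    show "\<forall>T a. (Some T, a) \<in> set (edges D') \<longrightarrow> wf_tp T \<and> arity T = length a"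
      using E' by (fastforce simp: tp_equiv_def)
  qed (rule None)
  \<comment> \<open>Inverse of \<open>\<pi>\<close> on the nodes, for the second use of
    \<open>tr_Div_hom\<close>.\<close>
  define \<rho> where "\<rho> = inv_into {..<nverts D} \<pi>"
  have \<rho>: "map \<rho> (map \<pi> a) = a" if "set a \<subseteq> {..<nverts D}" for a
    using map_inv_into_map[OF \<pi>(1) that] by (simp only: \<rho>_def)
  have b: "set (ext D) \<subseteq> {..<nverts D}" "set (dollar_att D) \<subseteq> {..<nverts D}"
    "\<And>l a. (l, a) \<in> set (edges D) \<Longrightarrow> set a \<subseteq> {..<nverts D}"
    using wf(2) \<open>(None, dollar_att D) \<in> _\<close> by (auto simp: wf_graph_def)
  have "\<gamma> \<turnstile> tr (Div N D) xs \<longleftrightarrow> \<gamma> \<turnstile> tr (Div N' D') xs"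
    if xs: "length xs = arity (Div N D)" for \<gamma> xs
  proof
    assume "\<gamma> \<turnstile> tr (Div N D) xs"
    then show "\<gamma> \<turnstile> tr (Div N' D') xs"
      using E N wf(5)
      by (intro tr_Div_hom[OF \<open>wf_tp (Div N D)\<close> wf' xs \<pi>(2) d'])
         (fastforce simp: tp_equiv_def)+
  next
    assume L: "\<gamma> \<turnstile> tr (Div N' D') xs"
    show "\<gamma> \<turnstile> tr (Div N D) xs"
    proof (rule tr_Div_hom[OF wf' \<open>wf_tp (Div N D)\<close> _ _ _ _ _ L])
      show "length xs = arity (Div N' D')" using xs d' by simp
      show "ext D = map \<rho> (ext D')" "dollar_att D = map \<rho> (dollar_att D')"
        using \<pi>(2) d' \<rho> b by simp_all
      show "\<delta> \<turnstile> tr N ys" if "length ys = length (ext D')" "\<delta> \<turnstile> tr N' ys" for \<delta> ys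
        using that N wf(5) \<pi>(2) by (auto simp: tp_equiv_def)
      fix T' a' assume "(Some T', a') \<in> set (edges D')"
      then obtain T a where T: "(Some T, a) \<in> set (edges D)" "a' = map \<pi> a" "tp_equiv T T'"
        "arity T = length a" using E' by blast
      then have "map \<rho> a' = a" using \<rho> b(3) by simp
      then show "\<exists>T. (Some T, map \<rho> a') \<in> set (edges D) \<and>
          (\<forall>\<delta> ys. length ys = length a' \<longrightarrow> \<delta> \<turnstile> tr T ys \<longrightarrow> \<delta> \<turnstile> tr T' ys)"
        using T by (auto simp: tp_equiv_def)
    qed
  qed
  then show ?case using wf' d' by (simp add: tp_equiv_def del: tr.simps)
next
  case (3 M M')
  from \<open>wf_tp (Times M)\<close> have wf: "wf_graph M"
    "\<And>T a. (T, a) \<in> set (edges M) \<Longrightarrow> wf_tp T \<and> arity T = length a"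
    by (auto elim: wf_tp_TimesE)
  define R where "R = (\<lambda>x y. teq x y \<and> (wf_tp x \<longrightarrow> tp_equiv x y))"
  have iso: "giso R M M'" using 3 by (simp add: R_def)
  obtain \<pi> where \<pi>: "bij_betw \<pi> {..<nverts M} {..<nverts M'}" "ext M' = map \<pi> (ext M)"
    and e: "\<And>l a. (l, a) \<in> set (edges M) \<Longrightarrow> \<exists>l'. R l l' \<and> (l', map \<pi> a) \<in> set (edges M')"
    and e': "\<And>l' a'. (l', a') \<in> set (edges M') \<Longrightarrow>
      \<exists>l a. R l l' \<and> (l, a) \<in> set (edges M) \<and> a' = map \<pi> a"
    using gisoE[OF iso] by metis
  have E: "\<exists>T'. (T', map \<pi> a) \<in> set (edges M') \<and> tp_equiv T T' \<and> arity T = length a"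
    if "(T, a) \<in> set (edges M)" for T a
    using e[OF that] wf(2)[OF that] by (auto simp: R_def)
  have E': "\<exists>T a. (T, a) \<in> set (edges M) \<and> a' = map \<pi> a \<and> tp_equiv T T' \<and> arity T = length a"
    if "(T', a') \<in> set (edges M')" for T' a'
    using e'[OF that] wf(2) by (fastforce simp: R_def)
  have wf': "wf_tp (Times M')"
  proof (rule wf_tp.intros)
    show "wf_graph M'" using giso_wf_graph[OF iso wf(1)] .
    show "\<forall>T a. (T, a) \<in> set (edges M') \<longrightarrow> wf_tp T \<and> arity T = length a"
      using E' by (fastforce simp: tp_equiv_def)
  qed
  define \<rho> where "\<rho> = inv_into {..<nverts M} \<pi>"
  have \<rho>: "map \<rho> (map \<pi> a) = a" if "set a \<subseteq> {..<nverts M}" for a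
    using map_inv_into_map[OF \<pi>(1) that] by (simp only: \<rho>_def)
  have b: "set (ext M) \<subseteq> {..<nverts M}"
    "\<And>l a. (l, a) \<in> set (edges M) \<Longrightarrow> set a \<subseteq> {..<nverts M}"
    using wf(1) by (auto simp: wf_graph_def)
  have "\<gamma> \<turnstile> tr (Times M) xs \<longleftrightarrow> \<gamma> \<turnstile> tr (Times M') xs"
    if xs: "length xs = arity (Times M)" for \<gamma> xs
  proof
    assume "\<gamma> \<turnstile> tr (Times M') xs"
    then show "\<gamma> \<turnstile> tr (Times M) xs"
      using E
      by (intro tr_Times_hom[OF \<open>wf_tp (Times M)\<close> wf' xs \<pi>(2)])
         (fastforce simp: tp_equiv_def)+
  next
    assume L: "\<gamma> \<turnstile> tr (Times M) xs"
    show "\<gamma> \<turnstile> tr (Times M') xs"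
    proof (rule tr_Times_hom[OF wf' \<open>wf_tp (Times M)\<close> _ _ _ L])
      show "length xs = arity (Times M')" using xs \<pi>(2) by simp
      show "ext M = map \<rho> (ext M')" using \<pi>(2) \<rho> b by simp
      fix T' a' assume "(T', a') \<in> set (edges M')"
      then obtain T a where T: "(T, a) \<in> set (edges M)" "a' = map \<pi> a" "tp_equiv T T'"
        "arity T = length a" using E' by blast
      then have "map \<rho> a' = a" using \<rho> b(2) by simp
      then show "\<exists>T. (T, map \<rho> a') \<in> set (edges M) \<and>
          (\<forall>\<delta> ys. length ys = length a' \<longrightarrow> \<delta> \<turnstile> tr T ys \<longrightarrow> \<delta> \<turnstile> tr T' ys)"
        using T by (auto simp: tp_equiv_def)
    qed
  qed
  then show ?case using wf' \<pi>(2) by (simp add: tp_equiv_def del: tr.simps)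
qed

subsection \<open>Replacement\<close>

lemma embed_map_hgraph [simp]: "embed (map_hgraph f H) = embed H"
  by (intro ext) (simp add: embed_def irank_def hgraph.map_sel)

lemma repl_aux_le: "c \<le> fst (repl_aux \<sigma> i c es)"
proof (induction \<sigma> i c es rule: repl_aux.induct)
  case (2 \<sigma> i c l a es)
  then show ?case by (cases "\<sigma> i") (auto simp: case_prod_unfold Let_def intro: le_trans[rotated])
qed simp

lemma repl_aux_keep:
  "j < length es \<Longrightarrow> \<sigma> (i + j) = None \<Longrightarrow> es ! j \<in> set (snd (repl_aux \<sigma> i c es))"
proof (induction \<sigma> i c es arbitrary: j rule: repl_aux.induct)
  case (2 \<sigma> i c l a es)
  show ?case
  proof (cases j)
    case 0
    then show ?thesis using 2 by (simp add: case_prod_unfold Let_def)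
  next
    case (Suc j')
    then show ?thesis using 2 by (cases "\<sigma> i") (auto simp: case_prod_unfold Let_def)
  qed
qed simp

text \<open>The starting number \<open>d\<close> of the copy stays existential: an assignment can be
  restricted to the copy whatever \<open>d\<close> is. Gluing needs the exact value and relies on
  \<open>edges_repl_sing\<close>.\<close>

lemma repl_aux_insert:
  "j < length es \<Longrightarrow> \<sigma> (i + j) = Some H \<Longrightarrow>
   \<exists>d. \<forall>l a. (l, a) \<in> set (edges H) \<longrightarrow>
     (l, map (embed H (snd (es ! j)) d) a) \<in> set (snd (repl_aux \<sigma> i c es))"
proof (induction \<sigma> i c es arbitrary: j rule: repl_aux.induct)
  case (2 \<sigma> i c l a es)
  show ?case
  proof (cases j)
    case 0
    then show ?thesis using 2 by (intro exI[of _ c]) (force simp: case_prod_unfold Let_def)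
  next
    case (Suc j')
    then have j': "j' < length es" "\<sigma> (Suc i + j') = Some H" using 2(3,4) by auto
    show ?thesis
    proof (cases "\<sigma> i")
      case None
      then show ?thesis using 2(1)[OF None j'] Suc by (fastforce simp: case_prod_unfold Let_def)
    next
      case (Some K)
      then show ?thesis using 2(2)[OF Some j'] Suc by (fastforce simp: case_prod_unfold Let_def)
    qed
  qed
qed simp

text \<open>Serves to type the edges of a result, since embedding a copy preserves labels and the
  lengths of attachments.\<close>

lemma repl_aux_origin:
  "(l, a) \<in> set (snd (repl_aux \<sigma> i c es)) \<Longrightarrow>
   \<exists>j<length es. (\<sigma> (i + j) = None \<and> es ! j = (l, a)) \<or>
     (\<exists>H d a'. \<sigma> (i + j) = Some H \<and> (l, a') \<in> set (edges H) \<and> a = map (embed H (snd (es ! j)) d) a')"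
proof (induction \<sigma> i c es rule: repl_aux.induct)
  case (2 \<sigma> i c k b es)
  let ?Q = "\<lambda>\<sigma> i es j. (\<sigma> (i + j) = None \<and> es ! j = (l, a)) \<or>
     (\<exists>H d a'. \<sigma> (i + j) = Some H \<and> (l, a') \<in> set (edges H) \<and> a = map (embed H (snd (es ! j)) d) a')"
  have shift: "\<exists>j<length ((k, b) # es). ?Q \<sigma> i ((k, b) # es) j"
    if ex: "\<exists>j<length es. ?Q \<sigma> (Suc i) es j"
  proof -
    obtain j where "j < length es" "?Q \<sigma> (Suc i) es j" using ex by blast
    then have "Suc j < length ((k, b) # es)" "?Q \<sigma> i ((k, b) # es) (Suc j)" by simp_all
    then show ?thesis by blast
  qed
  show ?case
  proof (cases "\<sigma> i")
    case None
    then consider "(l, a) = (k, b)" | "(l, a) \<in> set (snd (repl_aux \<sigma> (Suc i) c es))"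
      using 2(3) by (auto simp: case_prod_unfold Let_def)
    then show ?thesis
    proof cases
      case 1
      then show ?thesis using None by (intro exI[of _ 0]) simp
    next
      case 2
      then show ?thesis using "2.IH"(1)[OF None] shift by blast
    qed
  next
    case (Some H)
    then consider a' where "(l, a') \<in> set (edges H)" "a = map (embed H b c) a'"
      | "(l, a) \<in> set (snd (repl_aux \<sigma> (Suc i) (c + irank H (nverts H)) es))"
      using 2(3) by (auto simp: case_prod_unfold Let_def)
    then show ?thesis
    proof cases
      case 1
      then show ?thesis using Some by (intro exI[of _ 0]) auto
    next
      case 2
      then show ?thesis using "2.IH"(2)[OF Some] shift by blast
    qed
  qed
qed simp

lemma repl_sel [simp]:
  "nverts (repl G \<sigma>) = fst (repl_aux \<sigma> 0 (nverts G) (edges G))"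
  "edges (repl G \<sigma>) = snd (repl_aux \<sigma> 0 (nverts G) (edges G))"
  "ext (repl G \<sigma>) = ext G"
  by (simp_all add: repl_def case_prod_unfold Let_def)

lemma repl_aux_None: "(\<And>j. \<sigma> (i + j) = None) \<Longrightarrow> repl_aux \<sigma> i c es = (c, es)"
proof (induction \<sigma> i c es rule: repl_aux.induct)
  case (2 \<sigma> i c l a es)
  have "\<sigma> i = None" using 2(3)[of 0] by simp
  moreover have "\<sigma> (Suc i + j) = None" for j using 2(3)[of "Suc j"] by simp
  ultimately show ?case using 2(1) by simp
qed simp

lemma repl_aux_sing:
  "k < length es \<Longrightarrow> snd (repl_aux (sing (i + k) H) i c es) =
    take k es @ map (\<lambda>(l, a). (l, map (embed H (snd (es ! k)) c) a)) (edges H) @ drop (Suc k) es"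
proof (induction es arbitrary: i k)
  case (Cons e es)
  obtain l a where e: "e = (l, a)" by (cases e)
  show ?case
  proof (cases k)
    case 0
    moreover have "repl_aux (sing i H) (Suc i) c' es = (c', es)" for c'
      by (rule repl_aux_None) (simp add: sing_def)
    ultimately show ?thesis by (simp add: e sing_def Let_def)
  next
    case (Suc k')
    moreover have "sing (i + Suc k') H i = None" by (simp add: sing_def)
    ultimately show ?thesis
      using Cons.IH[of k' "Suc i"] Cons.prems by (simp add: e case_prod_unfold Let_def)
  qed
qed simp

lemma edges_repl_sing:
  "k < length (edges G) \<Longrightarrow> edges (repl G (sing k H)) =
    take k (edges G) @ map (\<lambda>(l, a). (l, map (embed H (snd (edges G ! k)) (nverts G)) a)) (edges H)
      @ drop (Suc k) (edges G)"
  using repl_aux_sing[of k "edges G" 0 H "nverts G"] by simp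

section \<open>Embedded copies and the gluing of assignments\<close>

lemma map_embed_ext:
  assumes "distinct (ext H)" "length a = length (ext H)"
  shows "map (embed H a c) (ext H) = a"
  using assms by (auto intro!: nth_equalityI simp: embed_def pos_nth)

text \<open>External nodes of the copy land on \<open>a\<close>, below \<open>n\<close>, where
  \<open>h\<close> already has the values of \<open>g\<close>. Internal nodes are numbered
  injectively from \<open>n\<close> on by \<open>irank\<close>, so there the value of
  \<open>g\<close> can be read back from the number.\<close>

lemma glue:
  assumes "map h a = map g (ext F)" "set a \<subseteq> {..<n}"
  obtains k where "\<And>v. v < n \<Longrightarrow> k v = h v" "\<And>v. k (embed F a n v) = g v"
proof
  define k where "k = (\<lambda>v. if v < n then h v
    else g (the_inv_into (- set (ext F)) (irank F) (v - n)))"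
  show "k v = h v" if "v < n" for v using that by (simp add: k_def)
  show "k (embed F a n v) = g v" for v
  proof (cases "v \<in> set (ext F)")
    case True
    have len: "length a = length (ext F)" using assms(1) by (metis length_map)
    then have "h (a ! pos (ext F) v) = g v"
      using assms(1) True pos_less[OF True] by (metis nth_map nth_pos)
    moreover have "a ! pos (ext F) v < n"
      using assms(2) len pos_less[OF True] by (metis lessThan_iff nth_mem subsetD)
    ultimately show ?thesis using True by (simp add: k_def embed_def)
  next
    case False
    have "inj_on (irank F) (- set (ext F))"
      using inj_on_length_filter_upt[of "\<lambda>w. w \<notin> set (ext F)"]
      by (auto simp: inj_on_def irank_def)
    then show ?thesis using False by (simp add: k_def embed_def the_inv_into_f_f)
  qed
qed

subsection \<open>Soundness of the rules\<close>

text \<open>The sequent unfolded by the impredicative clause for \<open>Times H\<close>; the rules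
  then act on assignments and never touch the existential prefix.\<close>

definition sound :: "tp hgraph \<Rightarrow> tp \<Rightarrow> bool" where
  "sound H A \<longleftrightarrow> (\<forall>\<gamma> g. edges_hold \<gamma> g (edges H) \<longrightarrow> \<gamma> \<turnstile> tr A (map g (ext H)))"

definition typed_edges :: "tp hgraph \<Rightarrow> bool" where
  "typed_edges H \<longleftrightarrow> (\<forall>T a. (T, a) \<in> set (edges H) \<longrightarrow> wf_tp T \<and> arity T = length a)"

text \<open>The rules \<open>divL\<close> and \<open>timesR\<close> put no well-formedness premise
  on the graphs of their subderivations, so the typing facts used for soundness are established
  along the same induction.\<close>

definition typed_seq :: "tp hgraph \<Rightarrow> tp \<Rightarrow> bool" where
  "typed_seq H A \<longleftrightarrow> typed_edges H \<and> distinct (ext H) \<and> set (ext H) \<subseteq> {..<nverts H} \<and>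
     length (ext H) = arity A \<and> wf_tp A"

text \<open>The cut performed at a replaced edge: the external nodes of the copy are sent to
  \<open>a\<close>, hence the succedent is obtained on the attachment of that edge.\<close>

lemma sound_embed:
  assumes "sound H A" "distinct (ext H)" "length a = length (ext H)"
    and "\<And>T b. (T, b) \<in> set (edges H) \<Longrightarrow> \<gamma> \<turnstile> tr T (map g (map (embed H a c) b))"
  shows "\<gamma> \<turnstile> tr A (map g a)"
proof -
  have "\<gamma> \<turnstile> tr A (map (g \<circ> embed H a c) (ext H))"
    using assms(1,4) unfolding sound_def by simp
  then show ?thesis using map_embed_ext[OF assms(2,3)] by (metis map_map)
qed

lemma hl_ax: "typed_seq (handle (Prim p k)) (Prim p k)" "sound (handle (Prim p k)) (Prim p k)"
  by (auto simp: typed_seq_def typed_edges_def handle_def sound_def wf_tp.intros)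

lemma hl_timesR:
  assumes "wf_tp (Times M)" "length Hs = length (edges M)"
    and IH: "\<And>i. i < length (edges M) \<Longrightarrow>
      typed_seq (Hs ! i) (fst (edges M ! i)) \<and> sound (Hs ! i) (fst (edges M ! i))"
  defines "R \<equiv> repl M (\<lambda>i. if i < length (edges M) then Some (Hs ! i) else None)"
  shows "typed_seq R (Times M)" "sound R (Times M)"
proof -
  have M: "wf_graph M" "\<And>T a. (T, a) \<in> set (edges M) \<Longrightarrow> wf_tp T \<and> arity T = length a"
    using assms(1) by (auto elim: wf_tp_TimesE)
  have "wf_tp T \<and> arity T = length a" if e: "(T, a) \<in> set (edges R)" for T a
  proof -
    obtain j d a' where "j < length (edges M)" "(T, a') \<in> set (edges (Hs ! j))" "a = map d a'"
      using repl_aux_origin[OF e[unfolded R_def repl_sel]] by (auto split: if_splits)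
    then show ?thesis using IH by (simp add: typed_seq_def typed_edges_def)
  qed
  moreover have "ext R = ext M" "nverts M \<le> nverts R"
    by (simp_all add: R_def repl_aux_le)
  ultimately show "typed_seq R (Times M)"
    using M(1) assms(1) by (auto simp: typed_seq_def typed_edges_def wf_graph_def)
  have "\<gamma> \<turnstile> tr (Times M) (map g (ext M))" if g: "edges_hold \<gamma> g (edges R)" for \<gamma> g
  proof -
    have "\<gamma> \<turnstile> tr T (map g a)" if e: "(T, a) \<in> set (edges M)" for T a
    proof -
      obtain i where i: "i < length (edges M)" "edges M ! i = (T, a)"
        using e by (auto simp: in_set_conv_nth)
      obtain d where d: "\<And>l b. (l, b) \<in> set (edges (Hs ! i)) \<Longrightarrow>
          (l, map (embed (Hs ! i) a d) b) \<in> set (edges R)"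
        using repl_aux_insert[of i "edges M" _ 0 "Hs ! i" "nverts M"] i by (fastforce simp: R_def)
      have s: "typed_seq (Hs ! i) T" "sound (Hs ! i) T" using IH[OF i(1)] i(2) by simp_all
      show ?thesis
      proof (rule sound_embed[OF s(2)])
        show "distinct (ext (Hs ! i))" "length a = length (ext (Hs ! i))"
          using s(1) M(2)[OF e] by (simp_all add: typed_seq_def)
        show "\<gamma> \<turnstile> tr T' (map g (map (embed (Hs ! i) a d) b))" if "(T', b) \<in> set (edges (Hs ! i))" for T' b
          using d[OF that] g by blast
      qed
    qed
    \<comment> \<open>The witness is \<open>g\<close> itself, at the world
      \<open>\<gamma>\<close>.\<close>
    then show ?thesis
      using assms(1) by (simp add: ent_tr_Times del: tr.simps) (use ent_refl in blast)
  qed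
  then show "sound R (Times M)" by (simp add: sound_def R_def del: tr.simps)
qed

lemma hl_timesL:
  assumes IH: "typed_seq (repl G (sing e F)) A" "sound (repl G (sing e F)) A"
    and e: "e < length (edges G)" "fst (edges G ! e) = Times F" and G: "wf_lgraph G"
  shows "typed_seq G A" "sound G A"
proof -
  show "typed_seq G A"
    using IH(1) G by (auto simp: typed_seq_def typed_edges_def wf_lgraph_def wf_graph_def)
  obtain a where a: "edges G ! e = (Times F, a)" using e(2) by (cases "edges G ! e") auto
  then have aG: "(Times F, a) \<in> set (edges G)" using e(1) by (metis nth_mem)
  then have F: "wf_tp (Times F)" "arity (Times F) = length a"
    using G unfolding wf_lgraph_def by blast+
  have bounded: "set b \<subseteq> {..<nverts G}" if "(l, b) \<in> set (edges G)" for l b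
    using that G by (auto simp: wf_lgraph_def wf_graph_def)
  have "\<gamma> \<turnstile> tr A (map g (ext G))" if g: "edges_hold \<gamma> g (edges G)" for \<gamma> g
  proof -
    \<comment> \<open>The clause for \<open>Times F\<close> is used with the succedent as its
      conclusion, so a witness \<open>h\<close> on the nodes of \<open>F\<close> may be assumed at a
      stronger world.\<close>
    have "\<delta> \<turnstile> tr A (map g (ext G))"
      if \<delta>: "\<delta> \<turnstile> \<gamma>" and h: "map h (ext F) = map g a" "edges_hold \<delta> h (edges F)" for \<delta> h
    proof -
      obtain k where k: "\<And>v. v < nverts G \<Longrightarrow> k v = g v" "\<And>v. k (embed F a (nverts G) v) = h v"
        using glue[OF h(1)[symmetric] bounded[OF aG]] by metis
      have kg: "map k b = map g b" if "set b \<subseteq> {..<nverts G}" for b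
        using that k(1) by auto
      have "\<delta> \<turnstile> tr T (map k b)" if Tb: "(T, b) \<in> set (edges (repl G (sing e F)))" for T b
      proof -
        consider "(T, b) \<in> set (edges G)"
          | b' where "(T, b') \<in> set (edges F)" "b = map (embed F a (nverts G)) b'"
          using Tb unfolding edges_repl_sing[OF e(1)]
          by (auto simp: a dest: in_set_takeD in_set_dropD)
        then show ?thesis
        proof cases
          case 1
          then show ?thesis using kg[OF bounded[OF 1]] g ent_trans[OF \<delta>] by metis
        next
          case 2
          then have "map k b = map h b'" using k(2) by simp
          then show ?thesis using h(2) 2(1) by metis
        qed
      qed
      then have "\<delta> \<turnstile> tr A (map k (ext G))" using IH(2) by (simp add: sound_def)
      moreover have "set (ext G) \<subseteq> {..<nverts G}"
        using G by (simp add: wf_lgraph_def wf_graph_def)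
      ultimately show ?thesis using kg by simp
    qed
    moreover have "\<gamma> \<turnstile> tr (Times F) (map g a)" using g aG by blast
    ultimately show ?thesis using F by (subst (asm) ent_tr_Times) auto
  qed
  then show "sound G A" by (simp add: sound_def)
qed

text \<open>Forcing the division hands over an assignment \<open>h\<close> on \<open>D\<close> that
  agrees at the \<open>None\<close> edge with the assignment \<open>g\<close> on the external nodes
  of \<open>F\<close>; glued together they cover the premise graph.\<close>

lemma hl_divR:
  assumes IH: "sound (map_hgraph the (repl D (sing d0 (map_hgraph Some F)))) N"
    and D: "wf_tp (Div N D)" "d0 < length (edges D)" "fst (edges D ! d0) = None"
    and F: "wf_lgraph F" "length (ext F) = arity (Div N D)"
  shows "typed_seq F (Div N D)" "sound F (Div N D)"
proof -
  show "typed_seq F (Div N D)"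
    using D(1) F by (auto simp: typed_seq_def typed_edges_def wf_lgraph_def wf_graph_def)
  have wf: "wf_graph D" "length (filter (\<lambda>(l,a). l = None) (edges D)) = 1"
    using D(1) by (auto elim: wf_tp_DivE)
  define u where "u = dollar_att D"
  have "edges D ! d0 = (None, snd (edges D ! d0))" using D(3) by (metis prod.collapse)
  then have d0: "edges D ! d0 = (None, u)"
    using dollar_att_eqI[OF wf(2)] D(2) unfolding u_def by (metis nth_mem)
  have bounded: "set b \<subseteq> {..<nverts D}" if "(l, b) \<in> set (edges D)" for l b
    using that wf(1) by (auto simp: wf_graph_def)
  have "\<gamma> \<turnstile> tr (Div N D) (map g (ext F))" if g: "edges_hold \<gamma> g (edges F)" for \<gamma> g
  proof -
    have "\<delta> \<turnstile> tr N (map h (ext D))"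
      if \<delta>: "\<delta> \<turnstile> \<gamma>" and h: "map h u = map g (ext F)"
        "\<forall>T a. (Some T, a) \<in> set (edges D) \<longrightarrow> \<delta> \<turnstile> tr T (map h a)" for \<delta> h
    proof -
      have "set u \<subseteq> {..<nverts D}" using bounded d0 D(2) by (metis nth_mem)
      then obtain k where k: "\<And>v. v < nverts D \<Longrightarrow> k v = h v"
        "\<And>v. k (embed F u (nverts D) v) = g v"
        using glue[OF h(1)] by metis
      have kh: "map k b = map h b" if "set b \<subseteq> {..<nverts D}" for b
        using that k(1) by auto
      have "\<delta> \<turnstile> tr T (map k b)"
        if Tb: "(T, b) \<in> set (edges (map_hgraph the (repl D (sing d0 (map_hgraph Some F)))))" for T b
      proof -
        obtain l where l: "T = the l" "(l, b) \<in> set (edges (repl D (sing d0 (map_hgraph Some F))))"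
          using Tb by (auto simp: hgraph.map_sel simp del: repl_sel)
        consider "(l, b) \<in> set (take d0 (edges D)) \<union> set (drop (Suc d0) (edges D))"
          | b' T' where "l = Some T'" "(T', b') \<in> set (edges F)" "b = map (embed F u (nverts D)) b'"
          using l(2) unfolding edges_repl_sing[OF D(2)] by (auto simp: d0 hgraph.map_sel)
        then show ?thesis
        proof cases
          case 1
          then obtain j where j: "j < length (edges D)" "j \<noteq> d0" "edges D ! j = (l, b)"
          proof
            assume "(l, b) \<in> set (take d0 (edges D))"
            then obtain i where "i < d0" "edges D ! i = (l, b)"
              by (auto simp: in_set_conv_nth)
            then show ?thesis using that[of i] D(2) by simp
          next
            assume "(l, b) \<in> set (drop (Suc d0) (edges D))"
            then obtain i where "i < length (edges D) - Suc d0" "edges D ! (Suc d0 + i) = (l, b)"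
              by (auto simp: in_set_conv_nth)
            then show ?thesis using that[of "Suc d0 + i"] by simp
          qed
          \<comment> \<open>Uniqueness of the \<open>None\<close> edge ensures that
            \<open>the\<close> recovers an actual type of \<open>D\<close>.\<close>
          then have "l \<noteq> None"
            using length_filter_eq_1_unique[OF wf(2) j(1) D(2)] d0 by auto
          then have e: "(Some T, b) \<in> set (edges D)" using j l(1) by (metis nth_mem option.collapse)
          show ?thesis using kh[OF bounded[OF e]] h(2) e by metis
        next
          case 2
          then have "map k b = map g b'" using k(2) by simp
          then show ?thesis using g 2 l(1) ent_trans[OF \<delta>] by (metis option.sel)
        qed
      qed
      then have "\<delta> \<turnstile> tr N (map k (ext D))" using IH by (simp add: sound_def hgraph.map_sel)
      moreover have "set (ext D) \<subseteq> {..<nverts D}" using wf(1) by (simp add: wf_graph_def)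
      ultimately show ?thesis using kh by simp
    qed
    then show ?thesis
      using D(1) F(2) unfolding u_def by (subst ent_tr_Div) auto
  qed
  then show "sound F (Div N D)" by (simp add: sound_def del: tr.simps)
qed

text \<open>An assignment on the result restricts along \<open>?m\<close> to \<open>D\<close> and
  from there to each \<open>Hs ! j\<close>. The subderivations force the types on the edges of
  \<open>D\<close>, the relabelled edge forces \<open>Div N D\<close>, and together they force
  \<open>N\<close> on the attachment of the removed edge, after which the sequent for
  \<open>H\<close> applies.\<close>

lemma hl_divL:
  assumes IH: "typed_seq H A" "sound H A"
    and e: "e < length (edges H)" "fst (edges H ! e) = N"
    and D: "wf_tp (Div N D)" "d0 < length (edges D)" "fst (edges D ! d0) = None"
    and IHs: "\<And>j. j < length (edges D) \<Longrightarrow> j \<noteq> d0 \<Longrightarrow>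
      typed_seq (Hs ! j) (the (fst (edges D ! j))) \<and> sound (Hs ! j) (the (fst (edges D ! j)))"
  shows "typed_seq (divL_graph H e N D d0 Hs) A" "sound (divL_graph H e N D d0 Hs) A"
proof -
  define R where "R = divL_graph H e N D d0 Hs"
  have wf: "wf_graph D" "length (filter (\<lambda>(l,a). l = None) (edges D)) = 1"
    "\<And>T a. (Some T, a) \<in> set (edges D) \<Longrightarrow> wf_tp T \<and> arity T = length a"
    "arity N = length (ext D)"
    using D(1) by (auto elim: wf_tp_DivE)
  define u where "u = dollar_att D"
  have "edges D ! d0 = (None, snd (edges D ! d0))" using D(3) by (metis prod.collapse)
  then have d0: "edges D ! d0 = (None, u)"
    using dollar_att_eqI[OF wf(2)] D(2) unfolding u_def by (metis nth_mem)
  obtain a where a: "edges H ! e = (N, a)" using e(2) by (cases "edges H ! e") auto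
  have aH: "(N, a) \<in> set (edges H)" using a e(1) by (metis nth_mem)
  then have la: "length a = length (ext D)"
    using IH(1) wf(4) by (auto simp: typed_seq_def typed_edges_def)
  let ?m = "embed D a (nverts H)" and ?n = "length (edges D)"
  \<comment> \<open>The edge list after insertion and relabelling: the edges of \<open>D\<close>
    fill the block from \<open>e\<close> to \<open>e + ?n - 1\<close>, with the former
    \<open>None\<close> edge at \<open>e + d0\<close>.\<close>
  define es where "es = (take e (map (map_prod Some id) (edges H))
    @ map (\<lambda>(l, b). (l, map ?m b)) (edges D)
    @ drop (Suc e) (map (map_prod Some id) (edges H)))[e + d0 := (Some (Div N D), map ?m u)]"
  define \<sigma> where "\<sigma> = (\<lambda>j. if e \<le> j \<and> j < e + ?n \<and> j \<noteq> e + d0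
    then Some (map_hgraph Some (Hs ! (j - e))) else None)"
  define c where "c = nverts (repl (map_hgraph Some H) (sing e D))"
  have H1: "edges (repl (map_hgraph Some H) (sing e D)) = take e (map (map_prod Some id) (edges H))
    @ map (\<lambda>(l, b). (l, map ?m b)) (edges D) @ drop (Suc e) (map (map_prod Some id) (edges H))"
    using edges_repl_sing[of e "map_hgraph Some H" D] e(1) a
    by (simp add: hgraph.map_sel id_def del: repl_sel)
  moreover have "\<dots> ! (e + d0) = (None, map ?m u)"
    using e(1) D(2) d0 by (simp add: nth_append)
  ultimately have "relab (repl (map_hgraph Some H) (sing e D)) (e + d0) (Some (Div N D)) =
      HGraph c es (ext H)"
    by (simp add: relab_def c_def es_def hgraph.map_sel del: repl_sel(1,2))
  then have R: "R = map_hgraph the (repl (HGraph c es (ext H)) \<sigma>)"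
    by (simp only: R_def divL_graph_def Let_def \<sigma>_def)
  have edges_R: "edges R = map (map_prod the id) (snd (repl_aux \<sigma> 0 c es))"
    and ext_R: "ext R = ext H" and nverts_R: "nverts R = fst (repl_aux \<sigma> 0 c es)"
    by (simp_all add: R hgraph.map_sel id_def)
  have len: "length es = length (edges H) + ?n - 1"
    using e(1) by (simp add: es_def)
  have es_low: "es ! i = map_prod Some id (edges H ! i)" if "i < e" for i
    using that e(1) by (simp add: es_def nth_append)
  have es_mid: "es ! (e + j) = (fst (edges D ! j), map ?m (snd (edges D ! j)))"
    if "j < ?n" "j \<noteq> d0" for j
    using that e(1) by (simp add: es_def nth_append case_prod_unfold)
  have es_dollar: "es ! (e + d0) = (Some (Div N D), map ?m u)"
    using e(1) D(2) by (simp add: es_def)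
  \<comment> \<open>One edge of \<open>H\<close> is exchanged for \<open>?n\<close> edges, so those
    behind \<open>e\<close> move by \<open>?n - 1\<close>; the subtraction is exact because
    \<open>i\<close> is positive.\<close>
  have es_high: "es ! (?n + i - 1) = map_prod Some id (edges H ! i)"
    if "e < i" "i < length (edges H)" for i
  proof -
    have "e + d0 \<noteq> ?n + i - 1" "\<not> ?n + i - 1 < e" "\<not> ?n + i - 1 - e < ?n"
      "Suc (e + (?n + i - 1 - e - ?n)) = i"
      using that D(2) by linarith+
    then show ?thesis using that e(1) by (simp add: es_def nth_append)
  qed
  have "wf_tp T \<and> arity T = length b" if Tb: "(T, b) \<in> set (edges R)" for T b
  proof -
    have typed: "wf_tp T \<and> arity T = length b" if "(T, b) \<in> set (edges H)" for T b
      using that IH(1) by (auto simp: typed_seq_def typed_edges_def)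
    obtain l where l: "T = the l" "(l, b) \<in> set (snd (repl_aux \<sigma> 0 c es))"
      using Tb by (auto simp: edges_R)
    obtain j where j: "j < length es" and cases: "(\<sigma> j = None \<and> es ! j = (l, b)) \<or>
      (\<exists>K d a'. \<sigma> j = Some K \<and> (l, a') \<in> set (edges K) \<and> b = map (embed K (snd (es ! j)) d) a')"
      using repl_aux_origin[OF l(2)] by auto
    show ?thesis
    proof (cases "\<sigma> j")
      case None
      then have es: "es ! j = (l, b)" using cases by simp
      \<comment> \<open>The positions left alone by the last replacement: before the block, the
        relabelled edge, behind the block.\<close>
      consider "j < e" | "j = e + d0" | "e + ?n \<le> j"
        using None unfolding \<sigma>_def by (metis not_le option.distinct(1))
      then show ?thesis
      proof cases
        case 1
        then have "edges H ! j = (T, b)" using es_low[OF 1] es l(1) by (cases "edges H ! j") auto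
        then show ?thesis using typed 1 e(1) by (metis nth_mem order.strict_trans)
      next
        case 2
        then show ?thesis using es es_dollar l(1) D(1) by (auto simp: u_def)
      next
        case 3
        define i where "i = Suc j - ?n"
        have i: "e < i" "i < length (edges H)" "j = ?n + i - 1"
          using 3 j len by (simp_all add: i_def)
        then have "edges H ! i = (T, b)" using es_high[OF i(1,2)] es l(1) by (cases "edges H ! i") auto
        then show ?thesis using typed i(2) by (metis nth_mem)
      qed
    next
      case (Some K)
      then have K: "K = map_hgraph Some (Hs ! (j - e))" "j - e < ?n" "j - e \<noteq> d0"
        by (auto simp: \<sigma>_def split: if_splits)
      obtain d a' where a': "(l, a') \<in> set (edges K)" "b = map d a'" using cases Some by auto
      then have "(T, a') \<in> set (edges (Hs ! (j - e)))" using l(1) K(1) by (auto simp: hgraph.map_sel)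
      then show ?thesis
        using IHs[OF K(2,3)] a'(2) by (simp add: typed_seq_def typed_edges_def)
    qed
  qed
  moreover have "nverts H \<le> c" by (simp add: c_def hgraph.map_sel repl_aux_le)
  then have "nverts H \<le> nverts R" using repl_aux_le nverts_R order.trans by metis
  ultimately show "typed_seq (divL_graph H e N D d0 Hs) A"
    unfolding R_def[symmetric]
    using IH(1) by (auto simp: typed_seq_def typed_edges_def ext_R)
  have "\<gamma> \<turnstile> tr A (map g (ext R))" if g: "edges_hold \<gamma> g (edges R)" for \<gamma> g
  proof -
    have keep: "\<gamma> \<turnstile> tr (the (fst (es ! j))) (map g (snd (es ! j)))"
      if "j < length es" "\<sigma> j = None" for j
    proof -
      have "es ! j \<in> set (snd (repl_aux \<sigma> 0 c es))"
        using repl_aux_keep[of j es \<sigma> 0 c] that by simp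
      then have "(the (fst (es ! j)), snd (es ! j)) \<in> set (edges R)"
        unfolding edges_R by (force simp: map_prod_def case_prod_unfold)
      then show ?thesis using g by blast
    qed
    have D_edge: "\<gamma> \<turnstile> tr T (map g (map ?m b))" if Tb: "(Some T, b) \<in> set (edges D)" for T b
    proof -
      obtain j where j: "j < ?n" "edges D ! j = (Some T, b)" using Tb by (auto simp: in_set_conv_nth)
      then have "j \<noteq> d0" using D(3) by auto
      have "\<sigma> (0 + (e + j)) = Some (map_hgraph Some (Hs ! j))"
        using j \<open>j \<noteq> d0\<close> by (simp add: \<sigma>_def)
      moreover have "e + j < length es" using j e(1) len by simp
      ultimately obtain d where d: "\<And>l a'. (l, a') \<in> set (edges (map_hgraph Some (Hs ! j))) \<Longrightarrow>
          (l, map (embed (map_hgraph Some (Hs ! j)) (snd (es ! (e + j))) d) a')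
            \<in> set (snd (repl_aux \<sigma> 0 c es))"
        using repl_aux_insert by blast
      have dR: "(T', map (embed (Hs ! j) (map ?m b) d) a') \<in> set (edges R)"
        if "(T', a') \<in> set (edges (Hs ! j))" for T' a'
      proof -
        have "(Some T', a') \<in> set (edges (map_hgraph Some (Hs ! j)))"
          using that by (force simp: hgraph.map_sel)
        from d[OF this] show ?thesis
          unfolding edges_R using es_mid[OF j(1) \<open>j \<noteq> d0\<close>] j(2) by force
      qed
      have s: "typed_seq (Hs ! j) T" "sound (Hs ! j) T"
        using IHs[OF j(1) \<open>j \<noteq> d0\<close>] j(2) by simp_all
      show ?thesis
      proof (rule sound_embed[OF s(2)])
        show "distinct (ext (Hs ! j))" "length (map ?m b) = length (ext (Hs ! j))"
          using s(1) wf(3)[OF Tb] by (simp_all add: typed_seq_def)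
        show "\<gamma> \<turnstile> tr T' (map g (map (embed (Hs ! j) (map ?m b) d) a'))"
          if "(T', a') \<in> set (edges (Hs ! j))" for T' a'
          using dR[OF that] g by blast
      qed
    qed
    have "\<gamma> \<turnstile> tr (Div N D) (map g (map ?m u))"
      using keep[of "e + d0"] es_dollar len D(2) e(1) by (simp add: \<sigma>_def del: tr.simps)
    \<comment> \<open>The division clause is applied at \<open>\<gamma>\<close> itself, with the
      assignment \<open>g \<circ> ?m\<close>.\<close>
    then have "\<gamma> \<turnstile> tr N (map (g \<circ> ?m) (ext D))"
      using D_edge D(1) by (subst (asm) ent_tr_Div) (auto simp: u_def)
    then have N: "\<gamma> \<turnstile> tr N (map g a)"
      using map_embed_ext[of D a] wf(1) la by (metis map_map wf_graph_def)
    have "\<gamma> \<turnstile> tr T (map g b)" if Tb: "(T, b) \<in> set (edges H)" for T b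
    proof -
      obtain i where i: "i < length (edges H)" "edges H ! i = (T, b)"
        using Tb by (auto simp: in_set_conv_nth)
      consider "i < e" | "i = e" | "e < i" by linarith
      then show ?thesis
      proof cases
        case 1
        then show ?thesis using keep[of i] es_low[OF 1] i e(1) len by (simp add: \<sigma>_def)
      next
        case 2
        then show ?thesis using N a i by simp
      next
        case 3
        have "\<not> ?n + i - 1 < e + ?n" "?n + i - 1 < length es" using 3 i(1) D(2) len by linarith+
        then show ?thesis
          using keep[of "?n + i - 1"] es_high[OF 3 i(1)] i(2) by (simp add: \<sigma>_def)
      qed
    qed
    then show ?thesis using IH(2) by (simp add: sound_def ext_R)
  qed
  then show "sound (divL_graph H e N D d0 Hs) A" by (simp add: sound_def R_def)
qed

lemma hl_iso:
  assumes IH: "typed_seq H A" "sound H A" and H: "giso teq H H'" and A: "teq A A'"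
  shows "typed_seq H' A'" "sound H' A'"
proof -
  have A': "tp_equiv A A'" using teq_tp_equiv[OF A] IH(1) by (simp add: typed_seq_def)
  obtain \<pi> where \<pi>: "bij_betw \<pi> {..<nverts H} {..<nverts H'}" "ext H' = map \<pi> (ext H)"
    and e: "\<And>l a. (l, a) \<in> set (edges H) \<Longrightarrow> \<exists>l'. teq l l' \<and> (l', map \<pi> a) \<in> set (edges H')"
    and e': "\<And>l' a'. (l', a') \<in> set (edges H') \<Longrightarrow>
      \<exists>l a. teq l l' \<and> (l, a) \<in> set (edges H) \<and> a' = map \<pi> a"
    using gisoE[OF H] by metis
  have typed: "wf_tp T \<and> arity T = length a" if "(T, a) \<in> set (edges H)" for T a
    using that IH(1) by (auto simp: typed_seq_def typed_edges_def)
  have "wf_tp T' \<and> arity T' = length a'" if Ta: "(T', a') \<in> set (edges H')" for T' a'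
  proof -
    obtain T a where T: "teq T T'" "(T, a) \<in> set (edges H)" "a' = map \<pi> a"
      using e'[OF Ta] by blast
    then show ?thesis using teq_tp_equiv[OF T(1)] typed[OF T(2)] by (simp add: tp_equiv_def)
  qed
  then show "typed_seq H' A'"
    using \<pi> IH(1) A'
    by (auto simp: typed_seq_def typed_edges_def tp_equiv_def distinct_map
        intro: inj_on_subset bij_betw_imp_inj_on dest: bij_betw_apply)
  have "\<gamma> \<turnstile> tr A' (map g (ext H'))" if g: "edges_hold \<gamma> g (edges H')" for \<gamma> g
  proof -
    have "\<gamma> \<turnstile> tr T (map (g \<circ> \<pi>) a)" if Ta: "(T, a) \<in> set (edges H)" for T a
    proof -
      obtain T' where T': "teq T T'" "(T', map \<pi> a) \<in> set (edges H')" using e[OF Ta] by blast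
      then have "\<gamma> \<turnstile> tr T' (map (g \<circ> \<pi>) a)" using g by fastforce
      then show ?thesis
        using teq_tp_equiv[OF T'(1)] typed[OF Ta] by (simp add: tp_equiv_def)
    qed
    then have "\<gamma> \<turnstile> tr A (map (g \<circ> \<pi>) (ext H))" using IH(2) by (simp add: sound_def)
    then show ?thesis using A' IH(1) \<pi>(2) by (simp add: tp_equiv_def typed_seq_def)
  qed
  then show "sound H' A'" by (simp add: sound_def)
qed

section \<open>Soundness of derivations and universal closure\<close>

lemma hl_sound: "hl H A \<Longrightarrow> typed_seq H A \<and> sound H A"
proof (induction rule: hl.induct)
  case (ax p k)
  then show ?case using hl_ax by blast
next
  case (divL H A e N D d0 Hs)
  then show ?case using hl_divL[of H A e N D d0 Hs] by blast
next
  case (divR D d0 F N)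
  then show ?case using hl_divR[of D d0 F N] by blast
next
  case (timesL G e F A)
  then show ?case using hl_timesL[of G e F A] by blast
next
  case (timesR M Hs)
  then show ?case using hl_timesR[of M Hs] by blast
next
  case (iso H A H' A')
  then show ?case using hl_iso[of H A H' A'] by blast
qed

text \<open>The context is empty, so the eigenvariable condition of \<open>AllI\<close> holds for
  every variable.\<close>

lemma nd_univ_close: "nd {} a \<Longrightarrow> nd {} (univ_close a)"
proof -
  assume "nd {} a"
  then have "nd {} (foldr All xs a)" for xs
    by (induction xs) (auto intro: AllI)
  then show ?thesis by (simp add: univ_close_def)
qed

theorem theorem9:
  assumes "seq_ok H A"
    and "hl H A"
  shows "nd {} (univ_close (vseq H A))"
proof -
  let ?is = "[0..<length (ext H)]"
  have "wf_tp (Times H)"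
    using assms(1) by (auto simp: seq_ok_def wf_lgraph_def intro: wf_tp.intros)
  moreover have "\<delta> \<turnstile> tr A ?is" if "map g (ext H) = ?is" "edges_hold \<delta> g (edges H)" for \<delta> g
    using hl_sound[OF assms(2)] that by (metis sound_def)
  \<comment> \<open>The antecedent is taken as the world, where the translation of
    \<open>Times H\<close> holds by reflexivity.\<close>
  ultimately have "tr (Times H) ?is \<turnstile> tr A ?is"
    using ent_tr_Times[of H ?is "tr (Times H) ?is"] by auto
  then show ?thesis by (simp add: vseq_def ent_def nd_univ_close del: tr.simps)
qed

end
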